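(* Let $f$ be an even entire function of order less than $2$ which is real on the real line and has only real roots, with series $$f(z)=\sum_{k=0}^\infty \gamma_{2k}\frac{z^{2k}}{(2k)!}.$$ For $r>0$ let $n_+(r)$ be the number of real roots of $f$ in $[0,r]$, and assume that there exists $\alpha\in(0,2)$ such that for every $x>0$, $\lim_{r\to\infty} n_+(xr)/n_+(r)=x^\alpha$. Define $$a_n=\left[\frac{1}{2n}\,n_+^{-1}\!\left(\frac{2n}{\pi\alpha\csc(\pi\alpha/2)}\right)\right]^2,\qquad n_+^{-1}(y)=\inf\{r>0: n_+(r)\ge y\}.$$ Fix $d\in\mathbb{N}$ and let $W_{d,n}$ be the degree $d$ (unshifted) even Jensen polynomial of $f^{(2n)}$. Then $$\lim_{n\to\infty}\frac{1}{\gamma_{2n}}W_{d,n}(a_n z)=4^d\,\frac{(d!)^2}{(2d)!}\,L_d^{(-1/2)}\!\left(\frac z4\right)$$ uniformly on compact subsets of the complex plane. Moreover, the polynomial on the right-hand side is the degree $d$ (unshifted) even Jensen polynomial of $\cos(z)$.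
   Context: Roots are counted with multiplicity. For an even entire function $h(z)=\sum_{k\ge0}\eta_k\frac{z^{2k}}{k!}$, the degree $d$ (unshifted, i.e. shift $0$) even Jensen polynomial of $h$ is $\sum_{k=0}^d\binom dk\eta_k z^k$. Equivalently, with $W_{m,0}$ the degree $m$ even Jensen polynomial of $f$, one has $W_{d,n}(z)=\frac{d!}{(n+d)!}M^nW_{n+d,0}(z)$, where $M=2(D+2zD^2)$ and $D=\frac{d}{dz}$. The generalized Laguerre polynomial is $L_d^{(-1/2)}(z)=\sum_{k=0}^d\frac{(-1)^k\left(d-\frac12\right)_{d-k}}{k!\,(d-k)!}z^k$, where $(x)_j=\prod_{i=1}^j(x-i+1)$ is the falling factorial. The coefficients $\gamma_{2n}$ are nonzero for all sufficiently large $n$, so the limit is meaningful. *)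

theory Defs
  imports "HOL-Complex_Analysis.Complex_Analysis"
begin

text \<open>The order of growth lives in \<^typ>\<open>ereal\<close>, so that functions of infinite order get the
  value \<open>\<infinity>\<close> (infimum of the empty set). Exponents are restricted to \<open>a \<ge> 0\<close>, since for
  \<open>a < 0\<close> the bound degenerates to boundedness and constants would get order \<open>-\<infinity>\<close>.\<close>

definition entire_order :: "(complex \<Rightarrow> complex) \<Rightarrow> ereal" where
  "entire_order f =
     Inf {ereal a |a. a \<ge> 0 \<and> (\<lambda>z. norm (f z)) \<in> O[at_infinity](\<lambda>z. exp (norm z powr a))}"

text \<open>Roots in \<open>[0, r]\<close> are counted with multiplicity; a root at 0 counts with its full
  multiplicity. For \<open>f\<close> entire and not identically zero the index set is finite and the
  multiplicity of a root is its (positive) \<^const>\<open>zorder\<close>.\<close>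

definition n_plus :: "(complex \<Rightarrow> complex) \<Rightarrow> real \<Rightarrow> nat" where
  "n_plus f r = (\<Sum>x | 0 \<le> x \<and> x \<le> r \<and> f (of_real x) = 0. nat (zorder f (of_real x)))"

definition n_plus_inv :: "(complex \<Rightarrow> complex) \<Rightarrow> real \<Rightarrow> real" where
  "n_plus_inv f y = Inf {r. r > 0 \<and> real (n_plus f r) \<ge> y}"

definition scale_seq :: "(complex \<Rightarrow> complex) \<Rightarrow> real \<Rightarrow> nat \<Rightarrow> real" where
  "scale_seq f \<alpha> n =
     (1 / (2 * real n) * n_plus_inv f (2 * real n / (pi * \<alpha> * (1 / sin (pi * \<alpha> / 2)))))\<^sup>2"

text \<open>For an even entire \<open>h\<close>, these are the coefficients \<open>\<eta>\<^sub>k\<close> of the normalised expansion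
  \<open>h(z) = (\<Sum>k. \<eta>\<^sub>k z\<^sup>2\<^sup>k / k!)\<close>; see \<open>jensen_coeff_eqI\<close> below. Note the \<open>k!\<close> (not \<open>(2k)!\<close>) in the
  denominator of the expansion.\<close>

definition jensen_coeff :: "(complex \<Rightarrow> complex) \<Rightarrow> nat \<Rightarrow> complex" where
  "jensen_coeff h k = fact k * ((deriv ^^ (2 * k)) h 0 / fact (2 * k))"

definition even_jensen_poly :: "nat \<Rightarrow> (complex \<Rightarrow> complex) \<Rightarrow> complex poly" where
  "even_jensen_poly d h = (\<Sum>k\<le>d. monom (of_nat (d choose k) * jensen_coeff h k) k)"

lemma jensen_coeff_eqI:
  assumes "\<And>z. (\<lambda>k. \<eta> k * z ^ (2 * k) / fact k) sums h z"
  shows "jensen_coeff h k = \<eta> k"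
proof -
  define c where "c n = (if even n then \<eta> (n div 2) / fact (n div 2) else 0)" for n
  have s: "(\<lambda>n. c n * z ^ n) sums h z" for z
  proof -
    have "(\<lambda>k. c (2 * k) * z ^ (2 * k)) sums h z"
      using assms[of z] by (simp add: c_def field_simps)
    moreover have "strict_mono (\<lambda>k::nat. 2 * k)"
      by (auto simp: strict_mono_def)
    moreover have "c n * z ^ n = 0" if "n \<notin> range (\<lambda>k. 2 * k)" for n
      using that by (auto simp: c_def elim!: evenE)
    ultimately show ?thesis
      using sums_mono_reindex[of "\<lambda>k. 2 * k" "\<lambda>n. c n * z ^ n" "h z"] by simp
  qed
  have "h has_fps_expansion Abs_fps c"
  proof (rule has_fps_expansionI)
    show "\<forall>\<^sub>F u in nhds 0. (\<lambda>n. fps_nth (Abs_fps c) n * u ^ n) sums h u"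
      using s by simp
  qed
  then have "fps_nth (Abs_fps c) (2 * k) = (deriv ^^ (2 * k)) h 0 / fact (2 * k)"
    by (rule fps_nth_fps_expansion)
  then have "jensen_coeff h k = fact k * (\<eta> k / fact k)"
    by (simp add: jensen_coeff_def c_def)
  then show ?thesis
    by simp
qed

definition falling_factorial :: "'a::comm_ring_1 \<Rightarrow> nat \<Rightarrow> 'a" where
  "falling_factorial x j = (\<Prod>i=1..j. x - of_nat i + 1)"

text \<open>Generalised Laguerre polynomial with parameter \<open>a\<close>, usually written with \<open>(a)\<close> as a
  superscript and \<open>d\<close> as a subscript.\<close>

definition laguerre_poly :: "'a::field_char_0 \<Rightarrow> nat \<Rightarrow> 'a poly" where
  "laguerre_poly a d =
     (\<Sum>k\<le>d. monom ((-1) ^ k * falling_factorial (of_nat d + a) (d - k) / (fact k * fact (d - k))) k)"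

end

theory Submission
  imports Defs
begin

text \<open>
  By evenness, \<open>f(z) = c z\<^sup>2\<^sup>m p(-z\<^sup>2)\<close> with an entire function \<open>p\<close> of order less than \<open>1\<close>, \<open>p(0) = 1\<close>,
  whose zeros are the numbers \<open>-y\<^sup>2\<close> for the positive roots \<open>y\<close> of \<open>f\<close>. The \<open>k\<close>-th coefficient of the
  rescaled Jensen polynomial is a fixed multiple of \<open>a\<^sub>n\<^sup>k \<gamma>\<^sub>2\<^sub>n\<^sub>+\<^sub>2\<^sub>k / \<gamma>\<^sub>2\<^sub>n\<close>, so everything reduces to the
  asymptotics of the ratios of consecutive Taylor coefficients of \<open>p\<close>: the claim is that
  \<open>a\<^sub>n \<gamma>\<^sub>2\<^sub>n\<^sub>+\<^sub>2 / \<gamma>\<^sub>2\<^sub>n\<close> tends to \<open>-1\<close>, and that this persists when \<open>\<gamma>\<close> is shifted but \<open>a\<^sub>n\<close> is not.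

  Since \<open>p\<close> has order less than \<open>1\<close>, it is the locally uniform limit of the products
  \<open>\<Prod> (1 + w / y\<^sup>2)\<close> over its zeros (\<open>Hadamard_order_less_one\<close>). Two things follow. First, the Taylor
  coefficients \<open>\<beta>\<^sub>k\<close> of \<open>p\<close> are nonnegative and log-concave, being limits of coefficients of polynomials
  with negative zeros. Second, \<open>\<mu>(x) = x p'(x) / p(x) = \<Sum> x / (x + y\<^sup>2)\<close>. The latter sum is an average
  of the counting function, \<open>\<Sum> r\<^sup>2 / (r\<^sup>2 + y\<^sup>2) = \<integral>\<^sub>0\<^sup>1 N(r \<surd>(t / (1 - t))) dt\<close>
  (\<open>Stieltjes_sum_eq_integral\<close>), so regular variation of index \<open>\<alpha> < 2\<close> and dominated convergence turn it
  into a Beta integral: \<open>\<mu>(r\<^sup>2) \<sim> C n\<^sub>+(r)\<close> with \<open>C = (\<pi>\<alpha>/2) / sin (\<pi>\<alpha>/2)\<close> (\<open>Stieltjes_average\<close>).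

  The number \<open>\<mu>(x)\<close> is the mean of the probability distribution on the natural numbers with weights
  proportional to \<open>\<beta>\<^sub>k x\<^sup>k\<close>. By log-concavity, as soon as \<open>x\<close> is smaller than \<open>\<beta>\<^sub>n / \<beta>\<^sub>n\<^sub>+\<^sub>1\<close> by a factor
  \<open>s > 1\<close>, these weights decay geometrically beyond \<open>n\<close>, and the mean is at most \<open>n + O\<^sub>s(1)\<close>; if \<open>x\<close> is
  larger by that factor, they decay geometrically below \<open>n\<close>, and the mean is at least \<open>n - O\<^sub>s(1)\<close>
  (\<open>mean_le_of_ratio\<close>, \<open>mean_ge_of_ratio\<close>). So with \<open>y\<^sub>n = \<surd>(\<beta>\<^sub>n / \<beta>\<^sub>n\<^sub>+\<^sub>1)\<close> one gets
  \<open>C n\<^sub>+(y\<^sub>n) \<sim> n\<close> (\<open>count_at_saddle_point\<close>), and inverting the regularly varying function \<open>n\<^sub>+\<close>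
  gives \<open>n\<^sub>+\<^sup>-\<^sup>1(n / C) \<sim> y\<^sub>n\<^sub>+\<^sub>j\<close> for every fixed shift \<open>j\<close> (\<open>generalized_inverse_asymptotics\<close>). Up to the
  factorials, this is the claim.
\<close>

section \<open>Power series of entire functions\<close>

lemma higher_deriv_power_series_0:
  fixes g :: "complex \<Rightarrow> complex"
  assumes "\<And>w. (\<lambda>n. c n * w ^ n) sums g w"
  shows "(deriv ^^ k) g 0 = fact k * c k"
proof -
  have "g has_fps_expansion Abs_fps c"
    by (rule has_fps_expansionI) (use assms in simp)
  then have "fps_nth (Abs_fps c) k = (deriv ^^ k) g 0 / fact k"
    by (rule fps_nth_fps_expansion)
  then show ?thesis by (simp add: field_simps)
qed

lemma higher_deriv_even_power_series_0:
  fixes g :: "complex \<Rightarrow> complex"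
  assumes "\<And>w. (\<lambda>n. c n * w ^ (2 * n)) sums g w"
  shows "(deriv ^^ (2 * k)) g 0 = fact (2 * k) * c k"
proof -
  have "(\<lambda>n. (if even n then c (n div 2) else 0) * w ^ n) sums g w" for w
  proof -
    have "strict_mono (\<lambda>k::nat. 2 * k)" by (auto simp: strict_mono_def)
    moreover have "(if even n then c (n div 2) else 0) * w ^ n = 0" if "n \<notin> range (\<lambda>k. 2 * k)" for n
      using that by (auto elim!: evenE)
    ultimately show ?thesis
      using sums_mono_reindex[of "\<lambda>k. 2 * k" "\<lambda>n. (if even n then c (n div 2) else 0) * w ^ n" "g w"] assms[of w]
      by simp
  qed
  from higher_deriv_power_series_0[OF this, of "2 * k"] show ?thesis by simp
qed

lemma entire_power_series:
  fixes g :: "complex \<Rightarrow> complex"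
  assumes "\<And>w. (\<lambda>n. c n * w ^ n) sums g w"
  shows "g holomorphic_on UNIV"
proof -
  have "g holomorphic_on ball 0 (norm w + 1)" for w
    by (rule power_series_holomorphic[where a = c]) (use assms in simp)
  then have "g field_differentiable at w" for w
    by (rule holomorphic_on_imp_differentiable_at[of _ "ball 0 (norm w + 1)"]) auto
  then show ?thesis by (simp add: holomorphic_on_def field_differentiable_at_within)
qed

text \<open>The operator \<open>w d/dw\<close> multiplies the \<open>n\<close>-th coefficient by \<open>n\<close>; this is what makes the logarithmic
derivative a mean value with respect to the weights \<open>c\<^sub>n w\<^sup>n\<close>.\<close>

lemma power_series_Euler_derivative:
  fixes g :: "complex \<Rightarrow> complex"
  assumes s: "\<And>w. (\<lambda>n. c n * w ^ n) sums g w"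
  shows "(\<lambda>n. of_nat n * c n * w ^ n) sums (w * deriv g w)"
proof -
  have sm: "summable (\<lambda>n. c n * w ^ n)" for w using s by (rule sums_summable)
  have g: "g = (\<lambda>w. \<Sum>n. c n * w ^ n)" using s by (auto simp: sums_iff)
  have "DERIV g w :> (\<Sum>n. diffs c n * w ^ n)"
    unfolding g by (rule termdiffs_strong_converges_everywhere[OF sm])
  then have d: "deriv g w = (\<Sum>n. diffs c n * w ^ n)" by (rule DERIV_imp_deriv)
  have "(\<lambda>n. of_nat n * c n * w ^ (n - Suc 0)) sums (\<Sum>n. diffs c n * w ^ n)"
    by (rule diffs_equiv[OF termdiff_converges_all[OF sm]])
  from sums_mult[OF this, of w]
  have "(\<lambda>n. w * (of_nat n * c n * w ^ (n - Suc 0))) sums (w * deriv g w)" by (simp add: d)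
  moreover have "w * (of_nat n * c n * w ^ (n - Suc 0)) = of_nat n * c n * w ^ n" for n
    by (cases n) auto
  ultimately show ?thesis by simp
qed

section \<open>Hadamard products of order less than one\<close>

lemma entire_finite_zeros:
  fixes f :: "complex \<Rightarrow> complex"
  assumes "f holomorphic_on UNIV" "f z0 \<noteq> 0"
  shows "finite {z. f z = 0 \<and> norm z \<le> r}"
proof (cases "f constant_on UNIV")
  case True
  then have "{z. f z = 0 \<and> norm z \<le> r} = {}" using assms(2) unfolding constant_on_def by force
  then show ?thesis by (metis finite.emptyI)
next
  case False
  have "finite {z\<in>cball 0 r. f z = 0}"
    by (rule holomorphic_compact_finite_zeros[OF assms(1) _ _ _ _ False]) auto
  moreover have "{z\<in>cball 0 r. f z = 0} = {z. f z = 0 \<and> norm z \<le> r}" by auto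
  ultimately show ?thesis by simp
qed

lemma entire_factor_zero:
  fixes p :: "complex \<Rightarrow> complex"
  assumes "p holomorphic_on UNIV" "p w0 \<noteq> 0"
  obtains q where "q holomorphic_on UNIV" "q \<zeta> \<noteq> 0"
    "\<And>w. p w = (w - \<zeta>) ^ nat (zorder p \<zeta>) * q w"
proof -
  define n where "n = nat (zorder p \<zeta>)"
  define g where "g = zor_poly p \<zeta>"
  obtain r where r: "r > 0" "g holomorphic_on cball \<zeta> r"
    and g: "\<And>w. w \<in> cball \<zeta> r \<Longrightarrow> p w = g w * (w - \<zeta>) ^ n \<and> g w \<noteq> 0"
    
  proof -
    have "\<exists>w\<in>UNIV. p w \<noteq> 0" using assms by blast
    then have "\<exists>r>0. cball \<zeta> r \<subseteq> UNIV \<and> g holomorphic_on cball \<zeta> r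
        \<and> (\<forall>w\<in>cball \<zeta> r. p w = g w * (w - \<zeta>) ^ n \<and> g w \<noteq> 0)"
      using zorder_exist_zero[of p UNIV \<zeta>] assms(1) connected_UNIV
      unfolding n_def g_def by (metis UNIV_I open_UNIV)
    then show ?thesis using that by blast
  qed
  define q where "q = (\<lambda>w. if w = \<zeta> then g \<zeta> else p w / (w - \<zeta>) ^ n)"
  have qg: "q w = g w" if "w \<in> ball \<zeta> r" for w
    using g[of w] that by (auto simp: q_def)
  have "q holomorphic_on ball \<zeta> r"
    by (rule holomorphic_transform[OF holomorphic_on_subset[OF r(2)]]) (auto simp: qg)
  moreover have "q holomorphic_on - {\<zeta>}"
  proof (rule holomorphic_transform)
    show "(\<lambda>w. p w / (w - \<zeta>) ^ n) holomorphic_on - {\<zeta>}"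
      by (intro holomorphic_intros holomorphic_on_subset[OF assms(1)]) auto
  qed (auto simp: q_def)
  ultimately have "q holomorphic_on (ball \<zeta> r \<union> - {\<zeta>})"
    by (rule holomorphic_on_Un) auto
  moreover have "ball \<zeta> r \<union> - {\<zeta>} = UNIV" using r by auto
  ultimately have "q holomorphic_on UNIV" by simp
  moreover have "q \<zeta> \<noteq> 0" using g[of \<zeta>] r by (auto simp: q_def)
  moreover have "p w = (w - \<zeta>) ^ n * q w" for w
    using g[of \<zeta>] r by (auto simp: q_def)
  ultimately show ?thesis using that unfolding n_def by blast
qed

text \<open>The zeros are removed one at a time; a zero of the remaining quotient has the same order as for \<open>p\<close>,
because the factors already split off do not vanish there. The factors \<open>1 - w / \<zeta>\<close> are normalised
at \<open>0\<close>, so the quotient keeps the value \<open>1\<close> there.\<close>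

lemma entire_factor_zeros:
  fixes p :: "complex \<Rightarrow> complex"
  assumes "finite S" "p holomorphic_on UNIV" "p 0 = 1" "\<And>\<zeta>. \<zeta> \<in> S \<Longrightarrow> p \<zeta> = 0"
  shows "\<exists>q. q holomorphic_on UNIV \<and> q 0 = 1 \<and> (\<forall>\<zeta>\<in>S. q \<zeta> \<noteq> 0) \<and>
    (\<forall>w. p w = (\<Prod>\<zeta>\<in>S. (1 - w / \<zeta>) ^ nat (zorder p \<zeta>)) * q w)"
  using assms(1,4)
proof (induction S)
  case empty
  show ?case using assms by auto
next
  case (insert \<zeta> S)
  define P where "P = (\<lambda>w. \<Prod>\<zeta>\<in>S. (1 - w / \<zeta>) ^ nat (zorder p \<zeta>))"
  have "\<forall>\<zeta>\<in>S. p \<zeta> = 0" using insert.prems by blast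
  then obtain q where q: "q holomorphic_on UNIV" "q 0 = 1" "\<And>\<zeta>. \<zeta> \<in> S \<Longrightarrow> q \<zeta> \<noteq> 0"
      "\<And>w. p w = P w * q w"
    using insert.IH insert.prems unfolding P_def by auto
  have nz: "\<eta> \<noteq> 0" if "\<eta> \<in> insert \<zeta> S" for \<eta> using insert.prems[OF that] assms(3) by auto
  have P\<zeta>: "P \<zeta> \<noteq> 0" unfolding P_def using insert.hyps nz by (auto simp: field_simps)
  obtain q2 where q2: "q2 holomorphic_on UNIV" "q2 \<zeta> \<noteq> 0"
    "\<And>w. q w = (w - \<zeta>) ^ nat (zorder q \<zeta>) * q2 w"
    using entire_factor_zero[of q 0 \<zeta>] q by auto
  define k where "k = nat (zorder q \<zeta>)"
  have holP: "P holomorphic_on UNIV" unfolding P_def using nz by (auto intro!: holomorphic_intros)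
  have z: "zorder p \<zeta> = int k"
    using q2(2) P\<zeta> by (intro zorder_eqI[of UNIV \<zeta> "\<lambda>w. P w * q2 w"] holomorphic_intros holP q2(1))
       (auto simp: q(4) q2(3)[folded k_def])
  define q3 where "q3 = (\<lambda>w. (-\<zeta>) ^ k * q2 w)"
  have eq: "q w = (1 - w / \<zeta>) ^ k * q3 w" for w
  proof -
    have "(1 - w / \<zeta>) ^ k * (-\<zeta>) ^ k = (w - \<zeta>) ^ k"
      using nz[of \<zeta>] by (simp flip: power_mult_distrib add: field_simps)
    then show ?thesis using q2(3)[of w] unfolding q3_def k_def by (metis mult.assoc)
  qed
  have "q3 holomorphic_on UNIV" unfolding q3_def by (intro holomorphic_intros q2)
  moreover have "q3 0 = 1" using eq[of 0] q(2) by simp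
  moreover have "q3 \<eta> \<noteq> 0" if "\<eta> \<in> insert \<zeta> S" for \<eta>
    using that q(3)[of \<eta>] eq[of \<eta>] q2(2) nz[of \<zeta>] by (auto simp: q3_def)
  moreover have "p w = (\<Prod>\<zeta>\<in>insert \<zeta> S. (1 - w / \<zeta>) ^ nat (zorder p \<zeta>)) * q3 w" for w
    using insert.hyps q(4)[of w] eq[of w] by (simp add: P_def z mult_ac)
  ultimately show ?case by blast
qed

text \<open>The map \<open>h \<mapsto> h / (2A - h)\<close> sends the half-plane \<open>Re h < A\<close> into the unit disc and fixes \<open>0\<close>, so
Schwarz's lemma applies to the composite on the rescaled disc.\<close>

lemma Borel_Caratheodory:
  fixes h :: "complex \<Rightarrow> complex"
  assumes hol: "h holomorphic_on ball 0 R" and h0: "h 0 = 0"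
    and A: "\<And>w. norm w < R \<Longrightarrow> Re (h w) < A" and w: "norm w < R"
  shows "norm (h w) * (R - norm w) \<le> 2 * A * norm w"
proof -
  have R: "R > 0" using w norm_ge_zero[of w] by linarith
  have Apos: "A > 0" using A[of 0] R h0 by simp
  have nz: "2 * of_real A - h u \<noteq> 0" if "norm u < R" for u
    using A[OF that] Apos by (auto simp: complex_eq_iff)
  define \<phi> where "\<phi> = (\<lambda>u. h (of_real R * u) / (2 * of_real A - h (of_real R * u)))"
  have lt: "norm (h u) < norm (2 * of_real A - h u)" if "norm u < R" for u
  proof -
    have "(Re (h u))\<^sup>2 < (2 * A - Re (h u))\<^sup>2"
      using mult_strict_left_mono[OF A[OF that] Apos] by (simp add: power2_eq_square algebra_simps)
    then show ?thesis by (simp add: norm_complex_def)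
  qed
  have sub: "norm (of_real R * u) < R" if "norm u < 1" for u :: complex
    using that R by (simp add: norm_mult)
  have hol2: "(\<lambda>u. h (of_real R * u)) holomorphic_on ball 0 1"
    by (rule holomorphic_on_compose_gen[OF _ hol, unfolded o_def])
       (use sub in \<open>auto intro!: holomorphic_intros\<close>)
  have "norm (\<phi> (w / of_real R)) \<le> norm (w / of_real R)"
  proof (rule Schwarz_Lemma)
    show "\<phi> holomorphic_on ball 0 1"
      unfolding \<phi>_def using nz sub by (intro holomorphic_intros hol2) auto
    show "\<phi> 0 = 0" by (simp add: \<phi>_def h0)
    show "norm (\<phi> z) < 1" if "norm z < 1" for z
      using lt[OF sub[OF that]] nz[OF sub[OF that]] by (simp add: \<phi>_def norm_divide divide_simps)
    show "norm (w / of_real R) < 1" using w R by (simp add: norm_divide)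
  qed
  then have "norm (h w) / norm (2 * of_real A - h w) \<le> norm w / R"
    using R by (simp add: \<phi>_def norm_divide)
  then have "norm (h w) * R \<le> norm w * norm (2 * of_real A - h w)"
    using R nz[OF w] by (simp add: field_simps)
  also have "\<dots> \<le> norm w * (2 * A + norm (h w))"
    using norm_triangle_ineq4[of "2 * of_real A" "h w"] Apos
    by (intro mult_left_mono) (auto simp: norm_mult)
  finally show ?thesis by (simp add: algebra_simps)
qed

text \<open>Dividing \<open>p\<close> by the factors of its zeros in the disc of radius \<open>R\<close> leaves a quotient \<open>q\<close> without
zeros in that disc. On the circle of radius \<open>2R\<close> each factor has modulus at least \<open>1\<close>, so there
\<open>q\<close> is bounded by \<open>p\<close>, and the maximum principle carries the bound inside. As \<open>q(0) = 1\<close>,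
Borel-Caratheodory then bounds the logarithm of \<open>q\<close>.\<close>

lemma genus_zero_quotient_bound:
  fixes p :: "complex \<Rightarrow> complex"
  assumes hol: "p holomorphic_on UNIV" and p0: "p 0 = 1" and R: "R > 0"
    and bd: "\<And>w. norm w = 2 * R \<Longrightarrow> norm (p w) < exp A"
    and w: "2 * norm w \<le> R"
  shows "\<exists>u. p w = (\<Prod>\<zeta> | p \<zeta> = 0 \<and> norm \<zeta> \<le> R. (1 - w / \<zeta>) ^ nat (zorder p \<zeta>)) * exp u
     \<and> norm u \<le> 4 * A * norm w / R"
proof -
  define S where "S = {\<zeta>. p \<zeta> = 0 \<and> norm \<zeta> \<le> R}"
  define P where "P = (\<lambda>w. \<Prod>\<zeta>\<in>S. (1 - w / \<zeta>) ^ nat (zorder p \<zeta>))"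
  have finS: "finite S"
    unfolding S_def using p0 by (intro entire_finite_zeros[OF hol, of 0]) simp
  obtain q where q: "q holomorphic_on UNIV" "q 0 = 1" "\<And>\<zeta>. \<zeta> \<in> S \<Longrightarrow> q \<zeta> \<noteq> 0"
      and pq: "\<And>w. p w = P w * q w"
  proof -
    have "p \<zeta> = 0" if "\<zeta> \<in> S" for \<zeta> using that by (simp add: S_def)
    from entire_factor_zeros[OF finS hol p0 this] that show ?thesis unfolding P_def by blast
  qed
  have nz: "q u \<noteq> 0" if "norm u \<le> R" for u
    using that q(3)[of u] pq[of u] by (auto simp: S_def)
  have "norm (q u) < exp A" if u: "norm u \<le> 2 * R" for u
  proof -
    have "compact (sphere (0::complex) (2 * R))" by simp
    moreover have "continuous_on (sphere 0 (2 * R)) (\<lambda>w. norm (p w))"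
      using hol by (intro continuous_intros holomorphic_on_imp_continuous_on) (auto intro: holomorphic_on_subset)
    moreover have "sphere (0::complex) (2 * R) \<noteq> {}" using R by simp
    ultimately obtain z where z: "z \<in> sphere 0 (2 * R)"
      "\<And>v. v \<in> sphere 0 (2 * R) \<Longrightarrow> norm (p v) \<le> norm (p z)"
      using continuous_attains_sup by (metis (no_types, lifting))
    have "norm (q u) \<le> norm (p z)"
    proof (rule maximum_modulus_frontier[of q "cball 0 (2 * R)"])
      show "q holomorphic_on interior (cball 0 (2 * R))" using q(1) by (rule holomorphic_on_subset) auto
      show "continuous_on (closure (cball 0 (2 * R))) q"
        using q(1) by (intro holomorphic_on_imp_continuous_on) (rule holomorphic_on_subset, auto)
      show "norm (q v) \<le> norm (p z)" if "v \<in> frontier (cball 0 (2 * R))" for v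
      proof -
        have v: "norm v = 2 * R" using that R by (simp add: frontier_cball sphere_def dist_norm)
        have "norm (P v) \<ge> 1"
        proof -
          have "1 \<le> norm ((1 - v / \<zeta>) ^ nat (zorder p \<zeta>))" if "\<zeta> \<in> S" for \<zeta>
          proof -
            have z: "\<zeta> \<noteq> 0" "norm \<zeta> \<le> R" using that p0 by (auto simp: S_def)
            have "2 \<le> norm (v / \<zeta>)" using z v by (simp add: norm_divide field_simps)
            then have "1 \<le> norm (1 - v / \<zeta>)"
              using norm_triangle_ineq2[of "v / \<zeta>" 1] by (simp add: norm_minus_commute)
            then show ?thesis by (simp add: norm_power)
          qed
          then show ?thesis unfolding P_def by (simp add: prod_ge_1 flip: prod_norm)
        qed
        then have "norm (q v) \<le> norm (P v) * norm (q v)"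
          using mult_right_mono[of 1 "norm (P v)" "norm (q v)"] by simp
        also have "\<dots> = norm (p v)" by (simp add: pq norm_mult)
        also have "\<dots> \<le> norm (p z)" using z(2)[of v] v by simp
        finally show ?thesis .
      qed
    qed (use u in auto)
    then show ?thesis using bd[of z] z(1) by simp
  qed note qbd = this
  obtain g where g: "g holomorphic_on ball 0 R" "\<And>z. z \<in> ball 0 R \<Longrightarrow> q z = exp (g z)"
    by (rule contractible_imp_holomorphic_log[of q "ball 0 R"])
       (use q(1) nz in \<open>auto intro: holomorphic_on_subset convex_imp_contractible\<close>)
  define h where "h = (\<lambda>z. g z - g 0)"
  have g0: "exp (g 0) = 1" using g(2)[of 0] q(2) R by simp
  have qh: "q z = exp (h z)" if "norm z < R" for z
    using g(2)[of z] that g0 by (simp add: h_def exp_diff)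
  have w': "norm w < R" using w R norm_ge_zero[of w] by linarith
  have "norm (h w) * (R - norm w) \<le> 2 * A * norm w"
  proof (rule Borel_Caratheodory[OF _ _ _ w'])
    show "h holomorphic_on ball 0 R" unfolding h_def by (intro holomorphic_intros g)
    show "Re (h v) < A" if "norm v < R" for v
      using qbd[of v] qh[OF that] that R by simp
  qed (simp add: h_def)
  moreover have "norm (h w) * (R / 2) \<le> norm (h w) * (R - norm w)"
    using w by (intro mult_left_mono) auto
  ultimately have "norm (h w) * (R / 2) \<le> 2 * A * norm w" by linarith
  then have "norm (h w) \<le> 4 * A * norm w / R" using R by (simp add: field_simps)
  then show ?thesis using pq[of w] qh[OF w'] unfolding P_def S_def by auto
qed

text \<open>Growth of order less than \<open>1\<close> makes the constant \<open>A\<close> in the preceding bound grow slower than the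
radius, so the logarithm of the quotient tends to \<open>0\<close> on compact sets.\<close>

theorem Hadamard_order_less_one:
  fixes p :: "complex \<Rightarrow> complex"
  assumes hol: "p holomorphic_on UNIV" and p0: "p 0 = 1" and a: "a < 1"
    and growth: "\<And>w. norm w \<ge> r0 \<Longrightarrow> norm (p w) \<le> C * exp (norm w powr a)"
  shows "uniform_limit (cball 0 r)
     (\<lambda>n w. \<Prod>\<zeta> | p \<zeta> = 0 \<and> norm \<zeta> \<le> real n. (1 - w / \<zeta>) ^ nat (zorder p \<zeta>)) p sequentially"
proof -
  define P where "P = (\<lambda>n w. \<Prod>\<zeta> | p \<zeta> = 0 \<and> norm \<zeta> \<le> real n. (1 - w / \<zeta>) ^ nat (zorder p \<zeta>))"
  \<comment> \<open>The number \<open>exp (A n)\<close> dominates \<open>p\<close> on the circle of radius \<open>2n\<close>.\<close>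
  define A where "A = (\<lambda>n. ln (\<bar>C\<bar> + 1) + (2 * real n) powr a)"
  define r' where "r' = \<bar>r\<bar> + 1"
  have r': "r' > 0" "r \<le> r'" by (auto simp: r'_def)
  have "compact (cball (0::complex) r')" by simp
  moreover have "continuous_on (cball 0 r') p"
    using hol by (intro holomorphic_on_imp_continuous_on) (auto intro: holomorphic_on_subset)
  ultimately have "bounded (p ` cball 0 r')" by (simp add: compact_continuous_image compact_imp_bounded)
  then obtain B where B: "\<And>w. norm w \<le> r' \<Longrightarrow> norm (p w) \<le> B" "B > 0"
    unfolding bounded_pos by (metis (no_types, lifting) imageI mem_cball_0)
  have lim0: "(\<lambda>n. 4 * A n * r' / real n) \<longlonglongrightarrow> 0" 
  proof -
    have "(\<lambda>n. (2 * real n) powr (a - 1)) \<longlonglongrightarrow> 0"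
    proof (rule tendsto_neg_powr)
      show "filterlim (\<lambda>n. 2 * real n) at_top sequentially" by real_asymp
    qed (use a in simp)
    moreover have "(\<lambda>n. ln (\<bar>C\<bar> + 1) / real n) \<longlonglongrightarrow> 0"
      by (rule lim_const_over_n)
    ultimately have "(\<lambda>n. 4 * r' * (ln (\<bar>C\<bar> + 1) / real n + 2 * (2 * real n) powr (a - 1))) \<longlonglongrightarrow> 4 * r' * (0 + 2 * 0)"
      by (intro tendsto_intros)
    moreover have "\<forall>\<^sub>F n in sequentially. 4 * r' * (ln (\<bar>C\<bar> + 1) / real n + 2 * (2 * real n) powr (a - 1))
        = 4 * A n * r' / real n"
      using eventually_gt_at_top[of 0]
    proof eventually_elim
      case (elim n)
      then have "2 * (2 * real n) powr (a - 1) = (2 * real n) powr a / real n"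
        by (simp add: powr_diff)
      then show ?case using elim by (simp add: A_def field_simps)
    qed
    ultimately show ?thesis by (simp add: filterlim_cong)
  qed
  then have "(\<lambda>n. B * (3 / 2 * (4 * A n * r' / real n))) \<longlonglongrightarrow> B * (3 / 2 * 0)"
    by (intro tendsto_intros)
  then have lim: "(\<lambda>n. B * (3 / 2 * (4 * A n * r' / real n)))\<longlonglongrightarrow> 0" by simp
  have "uniform_limit (cball 0 r) P p sequentially"
  proof (rule uniform_limitI)
    fix e :: real assume e: "e > 0"
    from order_tendstoD(2)[OF lim e]
    have "\<forall>\<^sub>F n in sequentially. B * (3 / 2 * (4 * A n * r' / real n)) < e" .
    moreover from order_tendstoD(2)[OF lim0, of "1/2"]
    have "\<forall>\<^sub>F n in sequentially. 4 * A n * r' / real n < 1/2" by simp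
    moreover have "\<forall>\<^sub>F n in sequentially. 2 * real n \<ge> r0" by real_asymp
    moreover have "\<forall>\<^sub>F n in sequentially. real n \<ge> 2 * r'" by real_asymp
    moreover have "\<forall>\<^sub>F n in sequentially. real n \<ge> 1" by real_asymp
    ultimately show "\<forall>\<^sub>F n in sequentially. \<forall>x\<in>cball 0 r. dist (P n x) (p x) < e"
    proof eventually_elim
      case (elim n)
      show ?case
      proof
        fix w :: complex assume "w \<in> cball 0 r"
        then have w: "norm w \<le> r'" using r' by simp
        have bd: "norm (p v) < exp (A n)" if "norm v = 2 * real n" for v
        proof -
          have "norm (p v) \<le> C * exp (norm v powr a)" using growth[of v] that elim by simp
          also have "\<dots> < (\<bar>C\<bar> + 1) * exp (norm v powr a)" by (intro mult_strict_right_mono) auto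
          also have "\<dots> = exp (A n)" using that by (simp add: A_def exp_add)
          finally show ?thesis .
        qed
        have Apos: "A n \<ge> 0" by (simp add: A_def)
        obtain u where u: "p w = P n w * exp u" "norm u \<le> 4 * A n * norm w / real n"
          using genus_zero_quotient_bound[OF hol p0, of "real n" "A n" w] bd elim w unfolding P_def by auto
        define t where "t = 4 * A n * r' / real n"
        have "norm u \<le> t"
          unfolding t_def using w Apos elim
          by (intro order_trans[OF u(2)] divide_right_mono mult_left_mono) auto
        have "P n w - p w = p w * (exp (- u) - 1)"
          using u(1) by (simp add: exp_minus field_simps)
        then have "dist (P n w) (p w) = norm (p w) * norm (exp (- u) - 1)" by (simp add: dist_norm norm_mult)
        also have "\<dots> \<le> B * (3 / 2 * t)"
        proof (rule mult_mono)
          have "t < 1 / 2" unfolding t_def by (rule elim)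
          then have "norm u \<le> 1 / 2" using \<open>norm u \<le> t\<close> by simp
          then show "norm (exp (- u) - 1) \<le> 3 / 2 * t"
            using norm_exp_bounds(2)[of "- u"] \<open>norm u \<le> t\<close> by simp
        qed (use B w in auto)
        also have "\<dots> < e" using elim unfolding t_def by simp
        finally show "dist (P n w) (p w) < e" .
      qed
    qed
  qed
  then show ?thesis unfolding P_def .
qed

section \<open>The product attached to an even function with real roots\<close>

text \<open>The index \<open>k0\<close> is the first one with a nonzero coefficient, so \<open>2 k0\<close> is the order of the zero of \<open>f\<close>
at the origin, and the sign makes the zeros of \<open>p\<close> negative when those of \<open>f\<close> are real.\<close>

lemma even_entire_substitution:
  fixes f :: "complex \<Rightarrow> complex" and b :: "nat \<Rightarrow> complex"
  assumes series: "\<And>z. (\<lambda>k. b k * z ^ (2 * k)) sums f z" and nz: "f z0 \<noteq> 0"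
  obtains k0 p where "b k0 \<noteq> 0" "p 0 = 1"
    "\<And>w. (\<lambda>k. (-1) ^ k * b (k + k0) / b k0 * w ^ k) sums p w"
    "\<And>z. f z = b k0 * z ^ (2 * k0) * p (- (z\<^sup>2))"
proof -
  define k0 where "k0 = (LEAST k. b k \<noteq> 0)"
  have "\<exists>k. b k \<noteq> 0"
  proof (rule ccontr)
    assume "\<nexists>k. b k \<noteq> 0"
    then have "(\<lambda>k. 0) sums f z0" using series[of z0] by simp
    then show False using nz by (simp add: sums_iff)
  qed
  then have c: "b k0 \<noteq> 0" unfolding k0_def by (rule LeastI_ex)
  have small: "b k = 0" if "k < k0" for k using not_less_Least[of k "\<lambda>k. b k \<noteq> 0"] that unfolding k0_def by blast
  define B where "B = (\<lambda>k. (-1) ^ k * b (k + k0) / b k0)"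
  have shifted: "(\<lambda>k. b k0 * z ^ (2 * k0) * (B k * (- (z\<^sup>2)) ^ k)) sums f z" for z
  proof -
    have "(\<Sum>k<k0. b k * z ^ (2 * k)) = 0" using small by (intro sum.neutral) auto
    then have "(\<lambda>k. b (k + k0) * z ^ (2 * (k + k0))) sums f z"
      using series[of z] by (subst sums_iff_shift) simp
    moreover have "b (k + k0) * z ^ (2 * (k + k0)) = b k0 * z ^ (2 * k0) * (B k * (- (z\<^sup>2)) ^ k)" for k
    proof -
      have "(- (z\<^sup>2)) ^ k = (-1) ^ k * z ^ (2 * k)"
        by (subst power_minus) (simp add: power_mult)
      moreover have "(-1) ^ k * (-1) ^ k = (1::complex)" by (simp flip: power_add)
      ultimately show ?thesis using c by (simp add: B_def field_simps power_add)
    qed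
    ultimately show ?thesis by simp
  qed
  have summ: "summable (\<lambda>k. B k * w ^ k)" for w
  proof (cases "w = 0")
    case True
    show ?thesis unfolding True by (rule summable_finite[of "{0}"]) auto
  next
    case False
    have e: "- ((csqrt (- w))\<^sup>2) = w" by simp
    have "summable (\<lambda>k. b k0 * csqrt (- w) ^ (2 * k0) * (B k * w ^ k))"
      using sums_summable[OF shifted[of "csqrt (- w)"]] unfolding e .
    then show ?thesis by (rule summable_mult_D) (use False c in simp)
  qed
  define p where "p = (\<lambda>w. \<Sum>k. B k * w ^ k)"
  have ps: "(\<lambda>k. B k * w ^ k) sums p w" for w unfolding p_def using summ by (rule summable_sums)
  have "p 0 = 1" unfolding p_def powser_zero using c by (simp add: B_def)
  moreover have "f z = b k0 * z ^ (2 * k0) * p (- (z\<^sup>2))" for z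
    using sums_unique2[OF shifted[of z] sums_mult[OF ps[of "- (z\<^sup>2)"]]] .
  ultimately show ?thesis using that[OF c] ps unfolding B_def by blast
qed

text \<open>Under \<open>w = -z\<^sup>2\<close> the order of growth is halved, so \<open>p\<close> has order less than \<open>1\<close>; away from the origin the
substitution is locally biholomorphic and preserves multiplicities.\<close>

lemma even_Hadamard_product:
  fixes f :: "complex \<Rightarrow> complex" and b :: "nat \<Rightarrow> complex"
  assumes series: "\<And>z. (\<lambda>k. b k * z ^ (2 * k)) sums f z" and nz: "f z0 \<noteq> 0"
    and order: "entire_order f < 2" and real_roots: "\<And>z. f z = 0 \<Longrightarrow> z \<in> \<real>"
  obtains k0 p where "b k0 \<noteq> 0" "p 0 = 1"
    "\<And>w. (\<lambda>k. (-1) ^ k * b (k + k0) / b k0 * w ^ k) sums p w"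
    "\<And>r. uniform_limit (cball 0 r) (\<lambda>n w. \<Prod>y | y \<in> {y. 0 < y \<and> f (of_real y) = 0} \<and> y \<le> sqrt (real n).
        (1 + w * of_real (1 / y\<^sup>2)) ^ nat (zorder f (of_real y))) p sequentially"
proof -
  obtain k0 p where c: "b k0 \<noteq> 0" and p0: "p 0 = 1"
    and ps: "\<And>w. (\<lambda>k. (-1) ^ k * b (k + k0) / b k0 * w ^ k) sums p w"
    and fp: "\<And>z. f z = b k0 * z ^ (2 * k0) * p (- (z\<^sup>2))"
    by (rule even_entire_substitution[OF series nz]) (rule that)
  have hol: "p holomorphic_on UNIV" by (rule entire_power_series[OF ps])
  obtain a where a: "a < 2" "(\<lambda>z. norm (f z)) \<in> O[at_infinity](\<lambda>z. exp (norm z powr a))"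
  proof -
    have "\<exists>x\<in>{ereal a |a. a \<ge> 0 \<and> (\<lambda>z. norm (f z)) \<in> O[at_infinity](\<lambda>z. exp (norm z powr a))}. x < 2"
      using order unfolding entire_order_def Inf_less_iff .
    then obtain a where "ereal a < 2" "(\<lambda>z. norm (f z)) \<in> O[at_infinity](\<lambda>z. exp (norm z powr a))"
      by blast
    then show ?thesis using that by simp
  qed
  obtain K where K: "K > 0" "\<forall>\<^sub>F z in at_infinity. norm (norm (f z)) \<le> K * norm (exp (norm z powr a))"
    using landau_o.bigE[OF a(2)] by blast
  then obtain R where R: "\<And>z. norm z \<ge> R \<Longrightarrow> norm (f z) \<le> K * exp (norm z powr a)"
    unfolding eventually_at_infinity real_norm_def abs_norm_cancel abs_exp_cancel by blast
  have growth: "norm (p w) \<le> K / norm (b k0) * exp (norm w powr (a / 2))" if w: "norm w \<ge> max 1 (R\<^sup>2)" for w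
  proof -
    define z where "z = csqrt (- w)"
    have zw: "- (z\<^sup>2) = w" by (simp add: z_def)
    have nz: "norm z = sqrt (norm w)" by (simp add: z_def)
    have "norm z \<ge> R" using w unfolding nz by (intro real_le_rsqrt) auto
    have "norm z \<ge> 1" using w unfolding nz by simp
    have "norm (b k0) * norm (p w) * 1 \<le> norm (b k0) * norm (p w) * norm z ^ (2 * k0)"
      using \<open>norm z \<ge> 1\<close> by (intro mult_left_mono one_le_power) auto
    also have "\<dots> = norm (f z)" by (simp add: fp zw norm_mult norm_power)
    also have "\<dots> \<le> K * exp (norm z powr a)" by (rule R) fact
    also have "norm z powr a = norm w powr (a / 2)"
      unfolding nz by (simp flip: powr_half_sqrt add: powr_powr)
    finally show ?thesis using c by (simp add: field_simps)
  qed
  have zero_iff: "p (- of_real (y\<^sup>2)) = 0 \<longleftrightarrow> f (of_real y) = 0" if "y > 0" for y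
    using c that by (simp add: fp)
  have zeros: "bij_betw (\<lambda>y. - complex_of_real (y\<^sup>2))
      {y. y \<in> {y. 0 < y \<and> f (of_real y) = 0} \<and> y \<le> sqrt (real n)} {\<zeta>. p \<zeta> = 0 \<and> norm \<zeta> \<le> real n}" for n
  proof (rule bij_betwI')
    fix x y :: real
    assume "x \<in> {y. y \<in> {y. 0 < y \<and> f (of_real y) = 0} \<and> y \<le> sqrt (real n)}"
      "y \<in> {y. y \<in> {y. 0 < y \<and> f (of_real y) = 0} \<and> y \<le> sqrt (real n)}"
    then have "x > 0" "y > 0" by auto
    have "- complex_of_real (x\<^sup>2) = - complex_of_real (y\<^sup>2) \<longleftrightarrow> x\<^sup>2 = y\<^sup>2"
      by (simp only: neg_equal_iff_equal of_real_eq_iff)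
    also have "\<dots> \<longleftrightarrow> x = y" using \<open>x > 0\<close> \<open>y > 0\<close> by simp
    finally show "- complex_of_real (x\<^sup>2) = - complex_of_real (y\<^sup>2) \<longleftrightarrow> x = y" .
  next
    fix y :: real
    assume y: "y \<in> {y. y \<in> {y. 0 < y \<and> f (of_real y) = 0} \<and> y \<le> sqrt (real n)}"
    then have "y\<^sup>2 \<le> real n" using real_sqrt_le_iff[of "y\<^sup>2" "real n"] by simp
    then show "- complex_of_real (y\<^sup>2) \<in> {\<zeta>. p \<zeta> = 0 \<and> norm \<zeta> \<le> real n}"
      using y zero_iff[of y] by (simp add: norm_power)
  next
    fix \<zeta> assume \<zeta>: "\<zeta> \<in> {\<zeta>. p \<zeta> = 0 \<and> norm \<zeta> \<le> real n}"
    have e: "- ((csqrt (- \<zeta>))\<^sup>2) = \<zeta>" by simp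
    have "f (csqrt (- \<zeta>)) = 0" using \<zeta> by (simp add: fp)
    then obtain x where x: "csqrt (- \<zeta>) = of_real x" using real_roots by (metis Reals_cases)
    define y where "y = \<bar>x\<bar>"
    have \<zeta>y: "\<zeta> = - of_real (y\<^sup>2)" using e unfolding x by (simp add: y_def)
    have "y \<noteq> 0" using \<zeta> p0 \<zeta>y by auto
    then have "y > 0" by (simp add: y_def)
    moreover have "y\<^sup>2 \<le> real n" using \<zeta> unfolding \<zeta>y by (simp add: norm_power)
    then have "y \<le> sqrt (real n)" by (rule real_le_rsqrt)
    ultimately show "\<exists>y\<in>{y. y \<in> {y. 0 < y \<and> f (of_real y) = 0} \<and> y \<le> sqrt (real n)}. \<zeta> = - complex_of_real (y\<^sup>2)"
      using \<zeta> zero_iff[of y] \<zeta>y by (intro bexI[of _ y]) auto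
  qed
  have multiplicity: "nat (zorder f (of_real y)) = nat (zorder p (- of_real (y\<^sup>2)))" if y: "y > 0" for y
  proof -
    define \<zeta> where "\<zeta> = - complex_of_real (y\<^sup>2)"
    define k where "k = nat (zorder p \<zeta>)"
    obtain q where q: "q holomorphic_on UNIV" "q \<zeta> \<noteq> 0" "\<And>w. p w = (w - \<zeta>) ^ k * q w"
    proof -
      have "p 0 \<noteq> 0" using p0 by simp
      from entire_factor_zero[OF hol this, of \<zeta>] that show ?thesis unfolding k_def by metis
    qed
    \<comment> \<open>Of the two linear factors of \<open>y\<^sup>2 - z\<^sup>2\<close> only \<open>y - z\<close> vanishes at \<open>z = y\<close>, so the order \<open>k\<close> is preserved.\<close>
    define g where "g = (\<lambda>z. b k0 * z ^ (2 * k0) * ((- (z + of_real y)) ^ k * q (- (z\<^sup>2))))"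
    have "zorder f (of_real y) = int k"
    proof (rule zorder_eqI[of UNIV _ g])
      have "(\<lambda>z. q (- (z\<^sup>2))) holomorphic_on UNIV"
        by (rule holomorphic_on_compose_gen[OF _ q(1), unfolded o_def]) (auto intro!: holomorphic_intros)
      then show "g holomorphic_on UNIV" unfolding g_def by (intro holomorphic_intros)
      show "g (of_real y) \<noteq> 0" using q(2) c y by (simp add: g_def \<zeta>_def add_eq_0_iff)
      show "f z = g z * (z - of_real y) powi int k" for z
      proof -
        have "- (z\<^sup>2) - \<zeta> = (- (z + of_real y)) * (z - of_real y)"
          by (simp add: \<zeta>_def power2_eq_square algebra_simps)
        then show ?thesis by (simp add: fp q(3) g_def power_mult_distrib mult_ac)
      qed
    qed auto
    then show ?thesis by (simp add: k_def \<zeta>_def)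
  qed
  have "uniform_limit (cball 0 r) (\<lambda>n w. \<Prod>y | y \<in> {y. 0 < y \<and> f (of_real y) = 0} \<and> y \<le> sqrt (real n).
        (1 + w * of_real (1 / y\<^sup>2)) ^ nat (zorder f (of_real y))) p sequentially" for r
  proof -
    have "(\<Prod>\<zeta> | p \<zeta> = 0 \<and> norm \<zeta> \<le> real n. (1 - w / \<zeta>) ^ nat (zorder p \<zeta>)) =
       (\<Prod>y | y \<in> {y. 0 < y \<and> f (of_real y) = 0} \<and> y \<le> sqrt (real n).
         (1 + w * of_real (1 / y\<^sup>2)) ^ nat (zorder f (of_real y)))" for n w
      unfolding prod.reindex_bij_betw[OF zeros, symmetric]
      by (intro prod.cong refl) (simp add: multiplicity)
    moreover have "a / 2 < 1" using a by simp
    note Hadamard_order_less_one[OF hol p0 this growth, of "max 1 (R\<^sup>2)" r]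
    ultimately show ?thesis by simp
  qed
  then show ?thesis using that[OF c p0 ps] by blast
qed

section \<open>Log-concave coefficient sequences\<close>

text \<open>For positive sequences this is the usual \<open>b\<^sub>i\<^sub>-\<^sub>1 b\<^sub>i\<^sub>+\<^sub>1 \<le> b\<^sub>i\<^sup>2\<close>. The form with two indices (total positivity
of order two) also excludes internal zeros and passes to limits.\<close>

definition log_concave_seq :: "(nat \<Rightarrow> real) \<Rightarrow> bool" where
  "log_concave_seq b \<longleftrightarrow> (\<forall>i. b i \<ge> 0) \<and> (\<forall>i j. i \<le> j \<longrightarrow> b i * b (Suc j) \<le> b (Suc i) * b j)"

text \<open>The difference of the two sides for the new coefficients is a polynomial in \<open>a\<close> of degree two, and
each of its coefficients is nonnegative by log-concavity of the old ones.\<close>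

lemma log_concave_mult_linear:
  assumes lc: "log_concave_seq (coeff P)" and a: "a \<ge> 0"
  shows "log_concave_seq (coeff ([:1, a:] * P))"
proof -
  define b where "b = coeff P"
  define b' where "b' = coeff ([:1, a:] * P)"
  have nn: "b i \<ge> 0" and lc': "i \<le> j \<Longrightarrow> b i * b (Suc j) \<le> b (Suc i) * b j" for i j
    using lc unfolding b_def log_concave_seq_def by auto
  have b'0: "b' 0 = b 0" by (simp add: b'_def b_def)
  have b'S: "b' (Suc i) = b (Suc i) + a * b i" for i
    by (simp add: b'_def b_def coeff_pCons)
  have "b' i \<ge> 0" for i using nn a by (cases i) (auto simp: b'0 b'S)
  moreover have "b' i * b' (Suc j) \<le> b' (Suc i) * b' j" if ij: "i \<le> j" for i j
  proof (cases i)
    case 0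
    show ?thesis
    proof (cases j)
      case 0
      then show ?thesis using \<open>i = 0\<close> by (simp add: mult.commute)
    next
      case (Suc j')
      have "b 0 * b (Suc j) \<le> b (Suc 0) * b j" using lc'[of 0 j] by simp
      moreover have "a * (b 0 * b j) \<le> a * (b 0 * b j) + a * (b (Suc 0) * b j') + a * a * (b 0 * b j')"
        using nn a by simp
      ultimately show ?thesis unfolding \<open>i = 0\<close> Suc b'0 b'S by (simp add: algebra_simps)
    qed
  next
    case (Suc i')
    then obtain j' where j: "j = Suc j'" using ij by (cases j) auto
    have "b i * b (Suc j) \<le> b (Suc i) * b j" using lc'[OF ij] .
    moreover have "a * a * (b i' * b j) \<le> a * a * (b i * b j')"
      using lc'[of i' j'] Suc j ij a by (intro mult_left_mono) auto
    moreover have "a * (b i' * b (Suc j)) \<le> a * (b (Suc i) * b j')"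
    proof (cases "i = j")
      case True
      then show ?thesis using Suc j by (simp add: mult.commute)
    next
      case False
      then have "i \<le> j'" using ij j by simp
      have "b i' * b (Suc j) \<le> b i * b j" using lc'[of i' j] Suc ij by simp
      also have "\<dots> \<le> b (Suc i) * b j'" using lc'[OF \<open>i \<le> j'\<close>] j by simp
      finally show ?thesis using a by (intro mult_left_mono)
    qed
    ultimately show ?thesis unfolding Suc j b'S by (simp add: algebra_simps)
  qed
  ultimately show ?thesis unfolding log_concave_seq_def b'_def by blast
qed

lemma log_concave_prod_linear:
  assumes "\<And>x. x \<in> S \<Longrightarrow> a x \<ge> 0"
  shows "log_concave_seq (coeff (\<Prod>x\<in>S. [:1, a x:] ^ m x))"
  using assms
proof (induction S rule: infinite_finite_induct)
  case (insert x S)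
  have "log_concave_seq (coeff ([:1, a x:] ^ k * (\<Prod>x\<in>S. [:1, a x:] ^ m x)))" for k
  proof (induction k)
    case 0
    then show ?case using insert by simp
  next
    case (Suc k)
    then show ?case
      using log_concave_mult_linear[OF Suc, of "a x"] insert.prems
      unfolding power_Suc mult.assoc by blast
  qed
  then show ?case using insert.hyps by simp
qed (auto simp: log_concave_seq_def coeff_pCons split: nat.splits)

lemma log_concave_limit:
  assumes "\<And>n. log_concave_seq (b n)" "\<And>i. (\<lambda>n. b n i) \<longlonglongrightarrow> c i"
  shows "log_concave_seq c"
  unfolding log_concave_seq_def
proof (intro conjI allI impI)
  show "c i \<ge> 0" for i
    by (rule LIMSEQ_le_const[OF assms(2)]) (use assms(1) in \<open>auto simp: log_concave_seq_def\<close>)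
  show "c i * c (Suc j) \<le> c (Suc i) * c j" if "i \<le> j" for i j
    by (rule LIMSEQ_le[OF tendsto_mult[OF assms(2) assms(2)] tendsto_mult[OF assms(2) assms(2)]])
       (use assms(1) that in \<open>auto simp: log_concave_seq_def\<close>)
qed

lemma log_concave_zero_tail:
  assumes "log_concave_seq b" "b n > 0" "b (Suc n) = 0" "k > n"
  shows "b k = 0"
proof -
  obtain j where k: "k = Suc j" "n \<le> j" using assms(4) by (cases k) auto
  have "b n * b k \<le> 0" "b k \<ge> 0"
    using assms(1,3) k unfolding log_concave_seq_def by (metis mult_zero_left)+
  then show ?thesis using assms(2) by (simp add: mult_le_0_iff)
qed

lemma arith_geometric_partial_sum_le:
  fixes t :: real
  assumes "0 < t" "t < 1" "finite A"
  shows "(\<Sum>j\<in>A. real j * t ^ j) \<le> 1 / (1 - t)\<^sup>2"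
proof -
  have s: "(\<lambda>n. real (Suc n) * t ^ n) sums (1 / (1 - t)\<^sup>2)"
    using geometric_deriv_sums[of t] assms by simp
  have "(\<Sum>j\<in>A. real j * t ^ j) \<le> (\<Sum>j\<in>A. real (Suc j) * t ^ j)"
    using assms by (intro sum_mono) (auto intro!: mult_right_mono)
  also have "\<dots> \<le> (\<Sum>n. real (Suc n) * t ^ n)"
    using assms s by (intro sum_le_suminf) (auto intro: sums_summable)
  finally show ?thesis using sums_unique[OF s] by simp
qed

text \<open>By log-concavity the ratio of consecutive weights \<open>b\<^sub>k x\<^sup>k\<close> is at most \<open>1 / s\<close> from \<open>n\<close> on. So the part
of the mean exceeding \<open>n\<close> is at most \<open>\<Sum> j s\<^sup>-\<^sup>j\<close> times the weight at \<open>n\<close>, which is at most the total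
mass \<open>p\<close>.\<close>

lemma mean_le_of_ratio:
  fixes b :: "nat \<Rightarrow> real"
  assumes lc: "log_concave_seq b" and pos: "\<And>n. b n > 0" and x: "x > 0" and s: "s > 1"
    and sum0: "(\<lambda>k. b k * x ^ k) sums p" and sum1: "(\<lambda>k. real k * b k * x ^ k) sums q"
    and ratio: "b (Suc n) * (x * s) \<le> b n"
  shows "q \<le> (real n + 1 / (1 - 1 / s)\<^sup>2) * p"
proof -
  define t where "t = 1 / s"
  have t: "0 < t" "t < 1" using s by (auto simp: t_def)
  define c where "c = (\<lambda>k. b k * x ^ k)"
  have cpos: "c k > 0" for k using pos x by (simp add: c_def)
  have step: "c (n + Suc j) \<le> t * c (n + j)" for j
  proof -
    have "b n * b (Suc (n + j)) \<le> b (Suc n) * b (n + j)"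
      using lc unfolding log_concave_seq_def by simp
    then have "b n * b (Suc (n + j)) * (x * s) \<le> b (Suc n) * (x * s) * b (n + j)"
      using x s by (simp add: mult_ac)
    also have "\<dots> \<le> b n * b (n + j)" using ratio pos[of "n + j"] by (intro mult_right_mono) auto
    finally have "b (Suc (n + j)) * (x * s) \<le> b (n + j)" using pos[of n] by (simp add: mult_ac)
    then have "b (Suc (n + j)) * x \<le> t * b (n + j)" using s by (simp add: t_def field_simps)
    then have "b (Suc (n + j)) * x * x ^ (n + j) \<le> t * b (n + j) * x ^ (n + j)"
      using x by (intro mult_right_mono) auto
    then show ?thesis by (simp add: c_def mult_ac)
  qed
  have geo: "c (n + j) \<le> t ^ j * c n" for j
  proof (induction j)
    case (Suc j)
    have "c (n + Suc j) \<le> t * c (n + j)" by (rule step)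
    also have "\<dots> \<le> t * (t ^ j * c n)" using Suc t by (intro mult_left_mono) auto
    finally show ?case by simp
  qed simp
  have "c n = sum c {n}" by simp
  also have "\<dots> \<le> p"
    using sum0 cpos unfolding c_def[symmetric]
    by (subst sums_unique[OF sum0[folded c_def]], intro sum_le_suminf) (auto intro: sums_summable less_imp_le)
  finally have cp: "c n \<le> p" .
  have fin: "(\<Sum>k<N. real k * c k) \<le> (real n + 1 / (1 - t)\<^sup>2) * p" for N
  proof -
    have "(\<Sum>k<N. real k * c k) \<le> (\<Sum>k<N. real n * c k + real (k - n) * t ^ (k - n) * c n)"
    proof (intro sum_mono)
      fix k
      show "real k * c k \<le> real n * c k + real (k - n) * t ^ (k - n) * c n"
      proof (cases "k \<le> n")
        case True
        then show ?thesis using cpos[of k] by simp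
      next
        case False
        then obtain j where k: "k = n + j" by (metis le_iff_add nat_le_linear)
        show ?thesis using mult_left_mono[OF geo[of j], of "real j"] unfolding k
          by (simp add: algebra_simps)
      qed
    qed
    also have "\<dots> = real n * (\<Sum>k<N. c k) + (\<Sum>k<N. real (k - n) * t ^ (k - n)) * c n"
      by (simp add: sum.distrib sum_distrib_left sum_distrib_right)
    also have "(\<Sum>k<N. real (k - n) * t ^ (k - n)) = (\<Sum>k\<in>{n..<N}. real (k - n) * t ^ (k - n))"
      by (rule sum.mono_neutral_right) auto
    also have "\<dots> = (\<Sum>j<N - n. real j * t ^ j)"
      by (rule sum.reindex_bij_witness[of _ "\<lambda>j. j + n" "\<lambda>k. k - n"]) auto
    also have "real n * (\<Sum>k<N. c k) + (\<Sum>j<N - n. real j * t ^ j) * c n \<le>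
        real n * p + 1 / (1 - t)\<^sup>2 * p"
    proof (intro add_mono mult_mono)
      show "(\<Sum>k<N. c k) \<le> p"
        using cpos by (subst sums_unique[OF sum0[folded c_def]], intro sum_le_suminf)
           (use sum0 in \<open>auto simp: c_def[symmetric] intro: sums_summable less_imp_le\<close>)
      show "(\<Sum>j<N - n. real j * t ^ j) \<le> 1 / (1 - t)\<^sup>2"
        using t by (intro arith_geometric_partial_sum_le) auto
    qed (use cp cpos t in \<open>auto intro!: sum_nonneg less_imp_le[OF cpos]\<close>)
    finally show ?thesis by (simp add: algebra_simps)
  qed
  have "(\<lambda>N. \<Sum>k<N. real k * c k) \<longlonglongrightarrow> q"
    using sum1 unfolding sums_def c_def by (simp add: mult.assoc)
  then show ?thesis unfolding t_def[symmetric] by (rule LIMSEQ_le_const2) (use fin in auto)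
qed

text \<open>The mirror image: here the weights decay geometrically when going down from \<open>n\<close>, so the mean can
fall short of \<open>n\<close> only by a bounded amount.\<close>

lemma mean_ge_of_ratio:
  fixes b :: "nat \<Rightarrow> real"
  assumes lc: "log_concave_seq b" and pos: "\<And>n. b n > 0" and x: "x > 0" and s: "s > 1"
    and sum0: "(\<lambda>k. b k * x ^ k) sums p" and sum1: "(\<lambda>k. real k * b k * x ^ k) sums q"
    and ratio: "b (Suc n) * x \<ge> s * b n"
  shows "q \<ge> (real n - 1 / (1 - 1 / s)\<^sup>2) * p"
proof -
  define t where "t = 1 / s"
  have t: "0 < t" "t < 1" using s by (auto simp: t_def)
  define c where "c = (\<lambda>k. b k * x ^ k)"
  have cpos: "c k > 0" for k using pos x by (simp add: c_def)
  have step: "c k \<le> t * c (Suc k)" if "k \<le> n" for k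
  proof -
    have "s * b n * b k \<le> b (Suc n) * x * b k" using ratio pos[of k] by (intro mult_right_mono) auto
    also have "\<dots> = (b k * b (Suc n)) * x" by simp
    also have "\<dots> \<le> (b (Suc k) * b n) * x"
      using lc that x unfolding log_concave_seq_def by (intro mult_right_mono) auto
    finally have "b n * (s * b k) \<le> b n * (b (Suc k) * x)" by (simp add: mult_ac)
    then have "s * b k \<le> b (Suc k) * x" using pos[of n] by simp
    then have "b k \<le> t * (b (Suc k) * x)" using s by (simp add: t_def field_simps)
    then have "b k * x ^ k \<le> t * (b (Suc k) * x) * x ^ k" using x by (intro mult_right_mono) auto
    then show ?thesis by (simp add: c_def mult_ac)
  qed
  have geo: "j \<le> n \<Longrightarrow> c (n - j) \<le> t ^ j * c n" for j
  proof (induction j)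
    case (Suc j)
    then have e: "Suc (n - Suc j) = n - j" by simp
    have "c (n - Suc j) \<le> t * c (n - j)" using step[of "n - Suc j"] unfolding e by simp
    also have "\<dots> \<le> t * (t ^ j * c n)" using Suc t by (intro mult_left_mono) auto
    finally show ?case by simp
  qed simp
  have "c n = sum c {n}" by simp
  also have "\<dots> \<le> p"
    using sum0 cpos unfolding c_def[symmetric]
    by (subst sums_unique[OF sum0[folded c_def]], intro sum_le_suminf) (auto intro: sums_summable less_imp_le)
  finally have cp: "c n \<le> p" .
  have fin: "(\<Sum>k<N. real n * c k) \<le> (\<Sum>k<N. real k * c k) + 1 / (1 - t)\<^sup>2 * p" for N
  proof -
    have "(\<Sum>k<N. real n * c k) \<le> (\<Sum>k<N. real k * c k + real (n - k) * t ^ (n - k) * c n)"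
    proof (intro sum_mono)
      fix k
      show "real n * c k \<le> real k * c k + real (n - k) * t ^ (n - k) * c n"
      proof (cases "n \<le> k")
        case True
        then show ?thesis using cpos[of k] by simp
      next
        case False
        then show ?thesis using mult_left_mono[OF geo[of "n - k"], of "real (n - k)"]
          by (simp add: algebra_simps of_nat_diff)
      qed
    qed
    also have "\<dots> = (\<Sum>k<N. real k * c k) + (\<Sum>k<N. real (n - k) * t ^ (n - k)) * c n"
      by (simp add: sum.distrib sum_distrib_left sum_distrib_right)
    also have "(\<Sum>k<N. real (n - k) * t ^ (n - k)) \<le> (\<Sum>k\<in>{..n}. real (n - k) * t ^ (n - k))"
    proof -
      have "(\<Sum>k<N. real (n - k) * t ^ (n - k)) = (\<Sum>k\<in>{..<N} \<inter> {..n}. real (n - k) * t ^ (n - k))"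
        by (rule sum.mono_neutral_right) auto
      also have "\<dots> \<le> (\<Sum>k\<in>{..n}. real (n - k) * t ^ (n - k))"
        using t by (intro sum_mono2) auto
      finally show ?thesis .
    qed
    also have "\<dots> = (\<Sum>j\<in>{..n}. real j * t ^ j)"
      by (rule sum.reindex_bij_witness[of _ "\<lambda>j. n - j" "\<lambda>k. n - k"]) auto
    also have "\<dots> \<le> 1 / (1 - t)\<^sup>2" using t by (intro arith_geometric_partial_sum_le) auto
    also have "1 / (1 - t)\<^sup>2 * c n \<le> 1 / (1 - t)\<^sup>2 * p" using cp by (intro mult_left_mono) auto
    finally show ?thesis using cpos[of n] by (simp add: mult_right_mono)
  qed
  have "(\<lambda>N. (\<Sum>k<N. real k * c k) + 1 / (1 - t)\<^sup>2 * p) \<longlonglongrightarrow> q + 1 / (1 - t)\<^sup>2 * p"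
    using sum1 unfolding sums_def c_def by (intro tendsto_intros) (simp add: mult.assoc)
  moreover have "(\<lambda>N. \<Sum>k<N. real n * c k) \<longlonglongrightarrow> real n * p"
    using sums_mult[OF sum0, of "real n"] unfolding sums_def c_def by (simp add: mult.assoc)
  ultimately have "real n * p \<le> q + 1 / (1 - t)\<^sup>2 * p" using fin by (intro LIMSEQ_le[of "\<lambda>N. \<Sum>k<N. real n * c k"]) auto
  then show ?thesis unfolding t_def[symmetric] by (simp add: algebra_simps)
qed

section \<open>Regular variation\<close>

text \<open>This is Euler's reflection formula; it is the source of the cosecant in the scaling.\<close>

lemma Beta_one_plus_one_minus:
  fixes \<beta> :: real
  assumes "0 < \<beta>" "\<beta> < 1"
  shows "Beta (1 + \<beta>) (1 - \<beta>) = pi * \<beta> / sin (pi * \<beta>)"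
proof -
  have "complex_of_real (Gamma \<beta> * Gamma (1 - \<beta>)) = complex_of_real (pi / sin (pi * \<beta>))"
    using Gamma_reflection_complex[of "of_real \<beta>"]
    by (simp flip: Gamma_complex_of_real sin_of_real add: of_real_mult)
  then have r: "Gamma \<beta> * Gamma (1 - \<beta>) = pi / sin (pi * \<beta>)" by (simp only: of_real_eq_iff)
  have "Gamma (1 + \<beta>) = \<beta> * Gamma \<beta>"
    using Gamma_plus1[of \<beta>] assms nonpos_Ints_nonpos[of \<beta>] by (auto simp: add.commute)
  then have "Beta (1 + \<beta>) (1 - \<beta>) = \<beta> * (Gamma \<beta> * Gamma (1 - \<beta>))"
    using Gamma_fact[of 1, where 'a = real] by (simp add: Beta_def)
  then show ?thesis unfolding r by simp
qed

lemma powr_has_bochner_integral_Beta: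
  assumes a: "a > 0" and b: "b > (0 :: real)"
  shows "has_bochner_integral (lebesgue_on {0<..<1}) (\<lambda>t. t powr (a - 1) * (1 - t) powr (b - 1)) (Beta a b)"
proof -
  define g where "g = (\<lambda>t. t powr (a - 1) * (1 - t) powr (b - 1))"
  have "(g has_integral Beta a b) {0<..<1}"
    using has_integral_Beta_real[OF a b] by (simp add: has_integral_Icc_iff_Ioo g_def)
  moreover from this have "g absolutely_integrable_on {0<..<1}"
    by (intro nonnegative_absolutely_integrable_1) (auto simp: g_def)
  ultimately have "integrable (lebesgue_on {0<..<1}) g" "integral\<^sup>L (lebesgue_on {0<..<1}) g = Beta a b"
    by (auto simp: absolutely_integrable_imp_integrable lebesgue_integral_eq_integral integral_unique)
  then show ?thesis unfolding g_def[symmetric] by (simp add: has_bochner_integral_iff)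
qed

text \<open>The case \<open>x = 1\<close> of the variation condition forces \<open>U\<close> to be eventually positive, because a quotient
with denominator zero is zero.\<close>

locale regularly_varying =
  fixes U :: "real \<Rightarrow> real" and \<alpha> :: real
  assumes mono: "r \<le> s \<Longrightarrow> U r \<le> U s" and nonneg: "U r \<ge> 0" and index_pos: "\<alpha> > 0"
    and variation: "x > 0 \<Longrightarrow> ((\<lambda>r. U (x * r) / U r) \<longlongrightarrow> x powr \<alpha>) at_top"
begin

lemma eventually_pos: "eventually (\<lambda>r. U r > 0) at_top"
proof -
  have "((\<lambda>r. U (1 * r) / U r) \<longlongrightarrow> 1 powr \<alpha>) at_top" by (rule variation) simp
  then have "eventually (\<lambda>r. U (1 * r) / U r > 1/2) at_top"
    by (rule order_tendstoD) simp
  then show ?thesis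
  proof eventually_elim
    case (elim r)
    then show ?case using nonneg[of r] by (cases "U r = 0") auto
  qed
qed

text \<open>Iterating \<open>U(2r) \<le> 2\<^sup>\<delta> U(r)\<close> bounds \<open>U\<close> at \<open>2\<^sup>k r\<close>; monotonicity fills in the values between, at the
price of the constant \<open>2\<^sup>\<delta>\<close>. The bound is uniform in \<open>u\<close> and provides the majorant for dominated
convergence.\<close>

lemma Potter_bound:
  assumes "\<alpha> < \<delta>"
  shows "eventually (\<lambda>r. U r > 0 \<and> (\<forall>u\<ge>1. U (u * r) \<le> 2 powr \<delta> * u powr \<delta> * U r)) at_top"
proof -
  have "2 powr \<alpha> < 2 powr \<delta>" using assms by simp
  then have "eventually (\<lambda>r. U (2 * r) / U r < 2 powr \<delta>) at_top"
    by (intro order_tendstoD(2)[OF variation]) auto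
  with eventually_pos have "eventually (\<lambda>r. U r > 0 \<and> U (2 * r) / U r < 2 powr \<delta>) at_top"
    by (rule eventually_conj)
  then obtain r0 where r0: "\<And>r. r \<ge> r0 \<Longrightarrow> U r > 0 \<and> U (2 * r) / U r < 2 powr \<delta>"
    unfolding eventually_at_top_linorder by blast
  have "U r > 0 \<and> (\<forall>u\<ge>1. U (u * r) \<le> 2 powr \<delta> * u powr \<delta> * U r)" if r: "r \<ge> max r0 0" for r
  proof (intro conjI allI impI)
    show "U r > 0" using r0 r by simp
    have pow: "U (2 ^ k * r) \<le> (2 powr \<delta>) ^ k * U r" for k
    proof (induction k)
      case (Suc k)
      have "1 * r \<le> 2 ^ k * r" using r by (intro mult_right_mono) auto
      then have k: "2 ^ k * r \<ge> r0" using r by simp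
      have "U (2 ^ Suc k * r) = U (2 * (2 ^ k * r))" by (simp add: mult_ac)
      also have "\<dots> \<le> 2 powr \<delta> * U (2 ^ k * r)" using r0[OF k] by (meson less_imp_le pos_divide_less_eq)
      also have "\<dots> \<le> 2 powr \<delta> * ((2 powr \<delta>) ^ k * U r)" using Suc by (intro mult_left_mono) auto
      finally show ?case by simp
    qed simp
    fix u :: real assume u: "u \<ge> 1"
    define k where "k = nat \<lceil>log 2 u\<rceil>"
    have lg: "log 2 u \<ge> 0" using u by simp
    have k1: "log 2 u \<le> real k" "real k \<le> log 2 u + 1" unfolding k_def using lg by linarith+
    have "u = 2 powr (log 2 u)" using u by simp
    also have "\<dots> \<le> 2 powr real k" using k1 by (intro powr_mono) auto
    finally have "u \<le> 2 ^ k" by (simp add: powr_realpow)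
    then have "U (u * r) \<le> U (2 ^ k * r)" using r by (intro mono mult_right_mono) auto
    also have "\<dots> \<le> (2 powr \<delta>) ^ k * U r" by (rule pow)
    also have "\<dots> \<le> (2 powr \<delta> * u powr \<delta>) * U r"
    proof (rule mult_right_mono)
      have "(2 powr \<delta>) ^ k = (2 powr real k) powr \<delta>"
        by (simp flip: powr_realpow add: powr_powr mult.commute)
      also have "\<dots> \<le> (2 powr (log 2 u + 1)) powr \<delta>"
        using k1 assms index_pos by (intro powr_mono2 powr_mono) auto
      also have "2 powr (log 2 u + 1) = 2 * u" using u by (simp add: powr_add)
      also have "(2 * u) powr \<delta> = 2 powr \<delta> * u powr \<delta>" using u by (simp add: powr_mult)
      finally show "(2 powr \<delta>) ^ k \<le> 2 powr \<delta> * u powr \<delta>" .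
    qed (rule nonneg)
    finally show "U (u * r) \<le> 2 powr \<delta> * u powr \<delta> * U r" .
  qed
  then show ?thesis unfolding eventually_at_top_linorder by blast
qed

lemma tendsto_infinity: "filterlim U at_top at_top"
proof -
  define c where "c = (1 + 2 powr \<alpha>) / 2"
  have two: "1 < 2 powr \<alpha>" using index_pos by simp
  then have c: "1 < c" "c < 2 powr \<alpha>" by (auto simp: c_def)
  then have "eventually (\<lambda>r. U (2 * r) / U r > c) at_top"
    by (intro order_tendstoD(1)[OF variation]) auto
  with eventually_pos have "eventually (\<lambda>r. U r > 0 \<and> U (2 * r) / U r > c) at_top"
    by (rule eventually_conj)
  then obtain r0 where r0: "\<And>r. r \<ge> r0 \<Longrightarrow> U r > 0 \<and> U (2 * r) / U r > c"
    unfolding eventually_at_top_linorder by blast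
  define r where "r = max r0 0"
  have pow: "U (2 ^ k * r) \<ge> c ^ k * U r" for k
  proof (induction k)
    case (Suc k)
    have "1 * r \<le> 2 ^ k * r" by (intro mult_right_mono) (auto simp: r_def)
    then have k: "2 ^ k * r \<ge> r0" by (simp add: r_def)
    have "c * (c ^ k * U r) \<le> c * U (2 ^ k * r)" using Suc c by (intro mult_left_mono) auto
    also have "\<dots> \<le> U (2 * (2 ^ k * r))" using r0[OF k] by (meson less_imp_le pos_less_divide_eq)
    finally show ?case by (simp add: mult_ac)
  qed simp
  show ?thesis unfolding filterlim_at_top
  proof
    fix Z
    obtain k where "c ^ k > Z / U r" using real_arch_pow[OF c(1)] by blast
    moreover have "U r > 0" using r0[of r] by (simp add: r_def)
    ultimately have "Z \<le> U (2 ^ k * r)" using pow[of k] by (simp add: field_simps)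
    then show "\<forall>\<^sub>F x in at_top. Z \<le> U x"
      using mono by (intro eventually_mono[OF eventually_ge_at_top[of "2 ^ k * r"]]) (meson order_trans)
  qed
qed

text \<open>After division by \<open>U(r)\<close> the integrand tends to \<open>(t / (1 - t))\<^sup>\<alpha>\<^sup>/\<^sup>2\<close>, whose integral is a Beta value.
Near \<open>t = 1\<close> the Potter bound with an exponent \<open>\<delta> < 2\<close> gives the integrable majorant
\<open>(1 - t)\<^sup>-\<^sup>\<delta>\<^sup>/\<^sup>2\<close>; this is where \<open>\<alpha> < 2\<close> is needed.\<close>

lemma Stieltjes_average:
  assumes "\<alpha> < 2"
  shows "((\<lambda>r. (\<integral>t. U (r * sqrt (t / (1 - t))) \<partial>lebesgue_on {0<..<1}) / U r)
           \<longlongrightarrow> (pi * \<alpha> / 2) / sin (pi * \<alpha> / 2)) at_top"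
proof -
  define M where "M = lebesgue_on {0<..<1::real}"
  define v where "v = (\<lambda>t::real. sqrt (t / (1 - t)))"
  \<comment> \<open>Any exponent strictly between \<open>\<alpha>\<close> and \<open>2\<close> serves for the majorant.\<close>
  define \<delta> where "\<delta> = (\<alpha> + 2) / 2"
  have \<delta>: "\<alpha> < \<delta>" "\<delta> < 2" "0 < \<delta>" using assms index_pos by (auto simp: \<delta>_def)
  have sp: "space M = {0<..<1}" by (simp add: M_def)
  have U_meas: "U \<in> borel_measurable borel" by (rule borel_measurable_mono) (auto simp: mono_def mono)
  have bm: "g \<in> borel_measurable M" if "g \<in> borel_measurable borel" for g :: "real \<Rightarrow> real"
    unfolding M_def using that by (intro measurable_restrict_space1) (simp add: measurable_completion)
  have lim: "((\<lambda>r. \<integral>t. U (r * v t) / U r \<partial>M) \<longlongrightarrow> (\<integral>t. t powr ((1 + \<alpha> / 2) - 1) * (1 - t) powr ((1 - \<alpha> / 2) - 1) \<partial>M)) at_top"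
  proof (rule integral_dominated_convergence_at_top)
    show "(\<lambda>t. t powr ((1 + \<alpha> / 2) - 1) * (1 - t) powr ((1 - \<alpha> / 2) - 1)) \<in> borel_measurable M"
      by (rule bm) measurable
    show "(\<lambda>t. U (r * v t) / U r) \<in> borel_measurable M" for r
      unfolding v_def by (rule bm) (use U_meas in measurable)
    show "integrable M (\<lambda>t. 2 powr \<delta> * (t powr (1 - 1) * (1 - t) powr ((1 - \<delta> / 2) - 1)))"
      unfolding M_def using powr_has_bochner_integral_Beta[of 1 "1 - \<delta> / 2"] \<delta>
      by (intro integrable_mult_right) (auto simp: has_bochner_integral_iff)
    show "AE t in M. ((\<lambda>r. U (r * v t) / U r) \<longlongrightarrow> t powr ((1 + \<alpha> / 2) - 1) * (1 - t) powr ((1 - \<alpha> / 2) - 1)) at_top"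
    proof (rule AE_I2)
      fix t assume "t \<in> space M"
      then have t: "0 < t" "t < 1" by (auto simp: sp)
      have "v t powr \<alpha> = t powr (\<alpha> / 2) / (1 - t) powr (\<alpha> / 2)"
        using t by (simp add: v_def flip: powr_half_sqrt) (simp add: powr_powr powr_divide)
      also have "\<dots> = t powr ((1 + \<alpha> / 2) - 1) * (1 - t) powr ((1 - \<alpha> / 2) - 1)"
        using t by (simp add: powr_minus_divide)
      finally have "v t powr \<alpha> = t powr ((1 + \<alpha> / 2) - 1) * (1 - t) powr ((1 - \<alpha> / 2) - 1)" .
      moreover have "v t > 0" using t by (simp add: v_def)
      ultimately show "((\<lambda>r. U (r * v t) / U r) \<longlongrightarrow> t powr ((1 + \<alpha> / 2) - 1) * (1 - t) powr ((1 - \<alpha> / 2) - 1)) at_top"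
        using variation[of "v t"] by (simp add: mult.commute)
    qed
    show "\<forall>\<^sub>F r in at_top. AE t in M. norm (U (r * v t) / U r) \<le>
        2 powr \<delta> * (t powr (1 - 1) * (1 - t) powr ((1 - \<delta> / 2) - 1))"
      using Potter_bound[OF \<delta>(1)] eventually_gt_at_top[of 0]
    proof eventually_elim
      case (elim r)
      show ?case
      proof (rule AE_I2)
        fix t assume "t \<in> space M"
        then have t: "0 < t" "t < 1" by (auto simp: sp)
        \<comment> \<open>Enlarging \<open>v t\<close> to \<open>u \<ge> 1\<close> brings small \<open>t\<close>, where \<open>v t < 1\<close>, into the range of the Potter bound.\<close>
        define u where "u = 1 / sqrt (1 - t)"
        have u: "u \<ge> 1" using t by (simp add: u_def)
        have "v t \<le> u" using t by (simp add: v_def u_def real_sqrt_divide divide_right_mono)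
        then have "U (r * v t) \<le> U (u * r)" using elim by (intro mono) (simp add: mult.commute)
        also have "\<dots> \<le> 2 powr \<delta> * u powr \<delta> * U r" using elim u by blast
        also have "u powr \<delta> = (1 - t) powr ((1 - \<delta> / 2) - 1)"
        proof -
          have "u powr \<delta> = 1 / (1 - t) powr (\<delta> / 2)"
            using t by (simp add: u_def flip: powr_half_sqrt) (simp add: powr_powr powr_divide)
          also have "\<dots> = (1 - t) powr ((1 - \<delta> / 2) - 1)"
            using t by (simp add: powr_minus_divide)
          finally show ?thesis .
        qed
        finally have "U (r * v t) / U r \<le> 2 powr \<delta> * (1 - t) powr ((1 - \<delta> / 2) - 1)"
          using elim by (simp add: field_simps)
        then show "norm (U (r * v t) / U r) \<le> 2 powr \<delta> * (t powr (1 - 1) * (1 - t) powr ((1 - \<delta> / 2) - 1))"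
          using t nonneg by simp
      qed
    qed
  qed
  have "(\<integral>t. t powr ((1 + \<alpha> / 2) - 1) * (1 - t) powr ((1 - \<alpha> / 2) - 1) \<partial>M) = Beta (1 + \<alpha> / 2) (1 - \<alpha> / 2)"
    unfolding M_def using powr_has_bochner_integral_Beta[of "1 + \<alpha> / 2" "1 - \<alpha> / 2"] assms index_pos
    by (intro has_bochner_integral_integral_eq) auto
  also have "\<dots> = (pi * \<alpha> / 2) / sin (pi * \<alpha> / 2)"
    using Beta_one_plus_one_minus[of "\<alpha> / 2"] assms index_pos by simp
  finally show ?thesis using lim unfolding M_def v_def by simp
qed

text \<open>The hypotheses place \<open>n\<close> between \<open>M(y\<^sub>n / \<sigma>)\<close> and \<open>M(y\<^sub>n \<sigma>)\<close> up to a bounded error. Since \<open>M \<sim> C U\<close>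
and scaling the argument by \<open>\<sigma>\<close> changes \<open>U\<close> by the factor \<open>\<sigma>\<^sup>\<alpha>\<close>, letting \<open>\<sigma>\<close> tend to \<open>1\<close> gives the
claim.\<close>

lemma count_at_saddle_point:
  fixes M :: "real \<Rightarrow> real" and y :: "nat \<Rightarrow> real"
  assumes C: "C > 0" and MU: "((\<lambda>r. M r / U r) \<longlongrightarrow> C) at_top"
    and M_mono: "\<And>r s. 0 < r \<Longrightarrow> r \<le> s \<Longrightarrow> M r \<le> M s"
    and y: "\<And>n. y n > 0"
    and upper: "\<And>\<sigma> n. \<sigma> > 1 \<Longrightarrow> M (y n / \<sigma>) \<le> real n + K \<sigma>"
    and lower: "\<And>\<sigma> n. \<sigma> > 1 \<Longrightarrow> M (y n * \<sigma>) \<ge> real n - K \<sigma>"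
  shows "filterlim y at_top sequentially" "(\<lambda>n. U (y n) / real n) \<longlonglongrightarrow> 1 / C"
proof -
  show y_top: "filterlim y at_top sequentially"
    unfolding filterlim_at_top_gt[where c = 0]
  proof safe
    fix Z :: real assume Z: "Z > 0"
    have "\<forall>\<^sub>F n in sequentially. real n > M (Z * 2) + K 2" by real_asymp
    then show "\<forall>\<^sub>F n in sequentially. Z \<le> y n"
    proof eventually_elim
      case (elim n)
      show ?case
      proof (rule ccontr)
        assume "\<not> Z \<le> y n"
        then have "M (y n * 2) \<le> M (Z * 2)" using y[of n] by (intro M_mono) auto
        then show False using lower[of 2 n] elim by simp
      qed
    qed
  qed
  have scale: "filterlim (\<lambda>n. y n * c) at_top sequentially" if "c > 0" for c
    using filterlim_tendsto_pos_mult_at_top[OF tendsto_const that y_top] by (simp add: mult.commute)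
  have part: "(\<lambda>n. (U (y n) / U (y n * c)) * (U (y n * c) / M (y n * c)) * (1 + L / real n)) \<longlonglongrightarrow> (1 / c) powr \<alpha> * (1 / C) * (1 + 0)"
    if c: "c > 0" for c L
  proof (intro tendsto_mult tendsto_add)
    have "((\<lambda>r. U ((1 / c) * r) / U r) \<longlongrightarrow> (1 / c) powr \<alpha>) at_top" using c by (intro variation) auto
    from filterlim_compose[OF this scale[OF c]]
    show "(\<lambda>n. U (y n) / U (y n * c)) \<longlonglongrightarrow> (1 / c) powr \<alpha>" using c by simp
    have "((\<lambda>r. inverse (M r / U r)) \<longlongrightarrow> inverse C) at_top" using C MU by (intro tendsto_inverse) auto
    from filterlim_compose[OF this scale[OF c]]
    show "(\<lambda>n. U (y n * c) / M (y n * c)) \<longlonglongrightarrow> 1 / C" by (simp add: inverse_eq_divide)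
    show "(\<lambda>n. L / real n) \<longlonglongrightarrow> 0" by (rule lim_const_over_n)
  qed auto
  have pos: "\<forall>\<^sub>F n in sequentially. U (y n * c) > 0 \<and> M (y n * c) > 0" if "c > 0" for c
  proof -
    have "\<forall>\<^sub>F r in at_top. M r / U r > 0" using order_tendstoD(1)[OF MU C] .
    then have "\<forall>\<^sub>F r in at_top. U r > 0 \<and> M r > 0"
      using eventually_pos by eventually_elim (simp add: zero_less_divide_iff)
    then show ?thesis by (rule eventually_compose_filterlim[OF _ scale[OF that]])
  qed
  show "(\<lambda>n. U (y n) / real n) \<longlonglongrightarrow> 1 / C"
  proof (rule order_tendstoI)
    fix a assume a: "a < 1 / C"
    have "((\<lambda>\<sigma>. (1 / \<sigma>) powr \<alpha> * (1 / C) * (1 + 0)) \<longlongrightarrow> (1 / 1) powr \<alpha> * (1 / C) * (1 + 0)) (at_right 1)"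
      by (intro tendsto_intros) auto
    then have "\<forall>\<^sub>F \<sigma> in at_right 1. (1 / \<sigma>) powr \<alpha> * (1 / C) * (1 + 0) > a"
      by (rule order_tendstoD(1)) (use a in simp)
    moreover have "\<forall>\<^sub>F \<sigma> in at_right (1::real). \<sigma> > 1" by (rule eventually_at_right_less)
    ultimately have "\<forall>\<^sub>F \<sigma> in at_right 1. \<sigma> > 1 \<and> (1 / \<sigma>) powr \<alpha> * (1 / C) * (1 + 0) > a"
      by eventually_elim auto
    from eventually_happens[OF this]
    obtain \<sigma> where \<sigma>: "\<sigma> > 1" "(1 / \<sigma>) powr \<alpha> * (1 / C) * (1 + 0) > a" by auto
    have "\<sigma> > 0" using \<sigma> by simp
    show "\<forall>\<^sub>F n in sequentially. a < U (y n) / real n"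
      using order_tendstoD(1)[OF part[OF \<open>\<sigma> > 0\<close>, of "- K \<sigma>"] \<sigma>(2)] pos[OF \<open>\<sigma> > 0\<close>] eventually_gt_at_top[of 0]
    proof eventually_elim
      case (elim n)
      have "a < (U (y n) / M (y n * \<sigma>)) * (1 - K \<sigma> / real n)" using elim by simp
      also have "\<dots> \<le> (U (y n) / M (y n * \<sigma>)) * (M (y n * \<sigma>) / real n)"
              proof (rule mult_left_mono)
          have "1 - K \<sigma> / real n = (real n - K \<sigma>) / real n" using elim by (simp add: diff_divide_distrib)
          also have "\<dots> \<le> M (y n * \<sigma>) / real n"
            using lower[OF \<sigma>(1), of n] by (intro divide_right_mono) auto
          finally show "1 - K \<sigma> / real n \<le> M (y n * \<sigma>) / real n" .
        qed (use elim nonneg[of "y n"] in simp)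
      also have "\<dots> = U (y n) / real n" using elim by simp
      finally show ?case .
    qed
  next
    fix a assume a: "a > 1 / C"
    have "((\<lambda>\<sigma>. (1 / (1 / \<sigma>)) powr \<alpha> * (1 / C) * (1 + 0)) \<longlongrightarrow> (1 / (1 / 1)) powr \<alpha> * (1 / C) * (1 + 0)) (at_right 1)"
      by (intro tendsto_intros) auto
    then have "\<forall>\<^sub>F \<sigma> in at_right 1. (1 / (1 / \<sigma>)) powr \<alpha> * (1 / C) * (1 + 0) < a"
      by (rule order_tendstoD(2)) (use a in simp)
    moreover have "\<forall>\<^sub>F \<sigma> in at_right (1::real). \<sigma> > 1" by (rule eventually_at_right_less)
    ultimately have "\<forall>\<^sub>F \<sigma> in at_right 1. \<sigma> > 1 \<and> (1 / (1 / \<sigma>)) powr \<alpha> * (1 / C) * (1 + 0) < a"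
      by eventually_elim auto
    from eventually_happens[OF this]
    obtain \<sigma> where \<sigma>: "\<sigma> > 1" "(1 / (1 / \<sigma>)) powr \<alpha> * (1 / C) * (1 + 0) < a" by auto
    have s0: "1 / \<sigma> > 0" using \<sigma> by simp
    show "\<forall>\<^sub>F n in sequentially. U (y n) / real n < a"
      using order_tendstoD(2)[OF part[OF s0, of "K \<sigma>"] \<sigma>(2)] pos[OF s0] eventually_gt_at_top[of 0]
    proof eventually_elim
      case (elim n)
      have "U (y n) / real n = (U (y n) / M (y n * (1 / \<sigma>))) * (M (y n * (1 / \<sigma>)) / real n)"
        using elim by simp
      also have "\<dots> \<le> (U (y n) / M (y n * (1 / \<sigma>))) * (1 + K \<sigma> / real n)"
        using upper[OF \<sigma>(1), of n] elim nonneg[of "y n"] by (intro mult_left_mono) (simp_all add: field_simps)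
      also have "\<dots> < a" using elim by simp
      finally show ?case .
    qed
  qed
qed

text \<open>For \<open>c < 1 < c'\<close> regular variation makes \<open>U(c y\<^sub>n)\<close> eventually smaller and \<open>U(c' y\<^sub>n)\<close> eventually larger
than \<open>w\<^sub>n / C\<close>, so the generalised inverse lies between \<open>c y\<^sub>n\<close> and \<open>c' y\<^sub>n\<close>. The sequence \<open>w\<close> is kept
apart from the index, because the lemma is used for shifts of one and the same sequence \<open>y\<close>.\<close>

lemma generalized_inverse_asymptotics:
  fixes y w :: "nat \<Rightarrow> real"
  assumes C: "C > 0" and y: "\<And>n. y n > 0" and y_top: "filterlim y at_top sequentially"
    and w: "eventually (\<lambda>n. w n > 0) sequentially"
    and Uy: "(\<lambda>n. U (y n) / w n) \<longlonglongrightarrow> 1 / C"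
  shows "(\<lambda>n. Inf {r. r > 0 \<and> U r \<ge> w n / C} / y n) \<longlonglongrightarrow> 1"
proof -
  have lim: "(\<lambda>n. U (c * y n) / w n) \<longlonglongrightarrow> c powr \<alpha> * (1 / C)" if "c > 0" for c
  proof -
    have "(\<lambda>n. (U (c * y n) / U (y n)) * (U (y n) / w n)) \<longlonglongrightarrow> c powr \<alpha> * (1 / C)"
      using filterlim_compose[OF variation[OF that] y_top] Uy by (rule tendsto_mult)
    moreover have "\<forall>\<^sub>F n in sequentially. U (y n) > 0"
      by (rule eventually_compose_filterlim[OF eventually_pos y_top])
    then have "\<forall>\<^sub>F n in sequentially. (U (c * y n) / U (y n)) * (U (y n) / w n) = U (c * y n) / w n"
      by eventually_elim simp
    ultimately show ?thesis by (rule Lim_transform_eventually)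
  qed
  have bdd: "bdd_below {r. r > 0 \<and> U r \<ge> a}" for a by (auto intro: bdd_belowI[of _ 0])
  have ne: "{r. r > 0 \<and> U r \<ge> a} \<noteq> {}" for a
  proof -
    have "\<forall>\<^sub>F r in at_top. U r \<ge> a" using tendsto_infinity by (simp add: filterlim_at_top)
    then have "\<forall>\<^sub>F r in at_top. r > 0 \<and> U r \<ge> a" using eventually_gt_at_top[of 0] by eventually_elim simp
    then show ?thesis using eventually_happens[of _ "at_top :: real filter"] by fastforce
  qed
  show ?thesis
  proof (rule order_tendstoI)
    fix a :: real assume "a < 1"
    define c where "c = (max a 0 + 1) / 2"
    have c: "0 < c" "c < 1" "a < c" using \<open>a < 1\<close> by (auto simp: c_def)
    have "c powr \<alpha> < 1 powr \<alpha>" using c index_pos by (intro powr_less_mono2) auto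
    then have "c powr \<alpha> * (1 / C) < 1 / C" using C by (simp add: divide_strict_right_mono)
    from order_tendstoD(2)[OF lim[OF c(1)] this] w
    show "\<forall>\<^sub>F n in sequentially. a < Inf {r. r > 0 \<and> U r \<ge> w n / C} / y n"
    proof eventually_elim
      case (elim n)
      then have *: "U (c * y n) < w n / C" by (simp add: field_simps)
      have "c * y n \<le> Inf {r. r > 0 \<and> U r \<ge> w n / C}"
      proof (rule cInf_greatest[OF ne])
        fix r assume "r \<in> {r. r > 0 \<and> U r \<ge> w n / C}"
        then show "c * y n \<le> r" using * mono[of r "c * y n"] by force
      qed
      then have "c \<le> Inf {r. r > 0 \<and> U r \<ge> w n / C} / y n" using y[of n] by (simp add: field_simps)
      then show ?case using c by simp
    qed
  next
    fix a :: real assume "a > 1"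
    define c where "c = (a + 1) / 2"
    have c: "1 < c" "0 < c" "c < a" using \<open>a > 1\<close> by (auto simp: c_def)
    have "1 powr \<alpha> < c powr \<alpha>" using c index_pos by (intro powr_less_mono2) auto
    then have "1 / C < c powr \<alpha> * (1 / C)" using C by (simp add: divide_strict_right_mono)
    from order_tendstoD(1)[OF lim[OF c(2)] this] w
    show "\<forall>\<^sub>F n in sequentially. Inf {r. r > 0 \<and> U r \<ge> w n / C} / y n < a"
    proof eventually_elim
      case (elim n)
      then have "U (c * y n) \<ge> w n / C" by (simp add: field_simps)
      then have "Inf {r. r > 0 \<and> U r \<ge> w n / C} \<le> c * y n"
        using c y[of n] by (intro cInf_lower bdd) simp
      then have "Inf {r. r > 0 \<and> U r \<ge> w n / C} / y n \<le> c" using y[of n] by (simp add: field_simps)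
      then show ?case using c by simp
    qed
  qed
qed
end

section \<open>Stieltjes sums over the zeros\<close>

text \<open>The condition \<open>y \<le> r \<surd>(t / (1 - t))\<close> says \<open>y\<^sup>2 / (r\<^sup>2 + y\<^sup>2) \<le> t\<close>, so the integral is the length of an
interval. This parametrisation of the half-line by \<open>(0, 1)\<close> is chosen so that the Stieltjes kernel
turns into Lebesgue measure.\<close>

lemma layer_cake_kernel:
  fixes r y :: real
  assumes r: "r > 0" and y: "y > 0"
  shows "integrable (lebesgue_on {0<..<1}) (\<lambda>t. of_bool (y \<le> r * sqrt (t / (1 - t))) :: real)"
    and "(\<integral>t. of_bool (y \<le> r * sqrt (t / (1 - t))) \<partial>lebesgue_on {0<..<1}) = r\<^sup>2 / (r\<^sup>2 + y\<^sup>2)"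
proof -
  define a where "a = y\<^sup>2 / (r\<^sup>2 + y\<^sup>2)"
  have pos: "r\<^sup>2 + y\<^sup>2 > 0" using r by (simp add: add_pos_nonneg)
  have a: "0 < a" "a < 1" using pos r y by (auto simp: a_def)
  have eq: "of_bool (y \<le> r * sqrt (t / (1 - t))) = (indicator {a..<1} t :: real)"
    if t: "t \<in> {0<..<1}" for t
  proof -
    have "y \<le> r * sqrt (t / (1 - t)) \<longleftrightarrow> y / r \<le> sqrt (t / (1 - t))"
      using r by (simp add: field_simps)
    also have "\<dots> \<longleftrightarrow> (y / r)\<^sup>2 \<le> t / (1 - t)"
    proof -
      have "y / r = sqrt ((y / r)\<^sup>2)" using r y by simp
      then show ?thesis by (metis real_sqrt_le_iff)
    qed
    also have "\<dots> \<longleftrightarrow> a \<le> t"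
      using r t pos by (simp add: a_def power_divide divide_simps) (simp add: algebra_simps)
    finally show ?thesis using t by (auto simp: indicator_def)
  qed
  have m: "{a..<1} \<in> sets (lebesgue_on {0<..<1})"
    using a by (auto simp: sets_restrict_space_iff)
  have em: "emeasure (lebesgue_on {0<..<1}) {a..<1} = ennreal (1 - a)"
    using a by (subst emeasure_restrict_space) auto
  have hb: "has_bochner_integral (lebesgue_on {0<..<1}) (indicator {a..<1} :: real \<Rightarrow> real) (1 - a)"
    using has_bochner_integral_real_indicator[OF m] em a by (simp add: measure_def)
  have "has_bochner_integral (lebesgue_on {0<..<1}) (\<lambda>t. of_bool (y \<le> r * sqrt (t / (1 - t))) :: real) (1 - a)"
    by (rule has_bochner_integral_cong[THEN iffD1, OF refl _ refl hb]) (use eq in simp)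
  moreover have "1 - a = r\<^sup>2 / (r\<^sup>2 + y\<^sup>2)" using pos r unfolding a_def by (simp add: divide_simps)
  ultimately show "integrable (lebesgue_on {0<..<1}) (\<lambda>t. of_bool (y \<le> r * sqrt (t / (1 - t))) :: real)"
    and "(\<integral>t. of_bool (y \<le> r * sqrt (t / (1 - t))) \<partial>lebesgue_on {0<..<1}) = r\<^sup>2 / (r\<^sup>2 + y\<^sup>2)"
    by (auto simp: has_bochner_integral_iff)
qed

text \<open>The kernel identity is summed over finitely many \<open>y\<close> and extended by monotone convergence.
Convergence of the sums is a hypothesis here; for the zeros of \<open>p\<close> it comes for free from the
convergence of the logarithmic derivatives.\<close>

lemma Stieltjes_sum_eq_integral:
  fixes Y :: "real set" and m :: "real \<Rightarrow> nat"
  assumes r: "r > 0" and Ypos: "\<And>y. y \<in> Y \<Longrightarrow> y > 0" and fin: "\<And>s. finite {y\<in>Y. y \<le> s}"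
    and lim: "(\<lambda>n. \<Sum>y | y \<in> Y \<and> y \<le> sqrt (real n). real (m y) * (r\<^sup>2 / (r\<^sup>2 + y\<^sup>2))) \<longlonglongrightarrow> s"
  shows "has_bochner_integral (lebesgue_on {0<..<1})
           (\<lambda>t. \<Sum>y | y \<in> Y \<and> y \<le> r * sqrt (t / (1 - t)). real (m y)) s"
proof -
  define v where "v = (\<lambda>t::real. r * sqrt (t / (1 - t)))"
  define F where "F = (\<lambda>n t. \<Sum>y | y \<in> Y \<and> y \<le> sqrt (real n). real (m y) * of_bool (y \<le> v t))"
  define N where "N = (\<lambda>s. \<Sum>y | y \<in> Y \<and> y \<le> s. real (m y))"
  have "mono N" unfolding mono_def N_def using fin by (auto intro!: sum_mono2)
  then have N_meas: "N \<in> borel_measurable borel" by (rule borel_measurable_mono)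
  have "(\<lambda>t. N (v t)) \<in> borel_measurable borel" unfolding v_def using N_meas by measurable
  then have Nv: "(\<lambda>t. N (v t)) \<in> borel_measurable (lebesgue_on {0<..<1})"
    by (intro measurable_restrict_space1) (simp add: measurable_completion)
  have FN: "F n t = N (min (sqrt (real n)) (v t))" for n t
    unfolding F_def N_def using fin[of "sqrt (real n)"]
    by (intro sum.mono_neutral_cong_right) auto
  have "has_bochner_integral (lebesgue_on {0<..<1}) (\<lambda>t. N (v t)) s"
  proof (rule has_bochner_integral_monotone_convergence[of _ F])
    show "integrable (lebesgue_on {0<..<1}) (F n)" for n
      unfolding F_def v_def by (intro Bochner_Integration.integrable_sum integrable_mult_right layer_cake_kernel r Ypos) auto
    show "AE t in lebesgue_on {0<..<1}. mono (\<lambda>n. F n t)"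
      unfolding FN using \<open>mono N\<close> by (intro AE_I2 monoI) (auto intro!: monoD[OF \<open>mono N\<close>] min.mono)
    show "AE t in lebesgue_on {0<..<1}. (\<lambda>n. F n t) \<longlonglongrightarrow> N (v t)"
    proof (rule AE_I2)
      fix t
      have "\<forall>\<^sub>F n in sequentially. sqrt (real n) \<ge> v t" by real_asymp
      then have "\<forall>\<^sub>F n in sequentially. F n t = N (v t)"
        unfolding FN by eventually_elim (simp add: min_absorb2)
      then show "(\<lambda>n. F n t) \<longlonglongrightarrow> N (v t)" by (rule tendsto_eventually)
    qed
    have "integral\<^sup>L (lebesgue_on {0<..<1}) (F n) =
        (\<Sum>y | y \<in> Y \<and> y \<le> sqrt (real n). real (m y) * (r\<^sup>2 / (r\<^sup>2 + y\<^sup>2)))" for n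
      unfolding F_def v_def using layer_cake_kernel[OF r Ypos]
      by (subst Bochner_Integration.integral_sum) (auto intro!: sum.cong)
    then show "(\<lambda>n. integral\<^sup>L (lebesgue_on {0<..<1}) (F n)) \<longlonglongrightarrow> s" using lim by simp
  qed (rule Nv)
  then show ?thesis unfolding N_def v_def .
qed

section \<open>Taylor coefficients of a product with negative zeros\<close>

text \<open>Locally uniform convergence of holomorphic functions entails convergence of all derivatives at \<open>0\<close>.\<close>

lemma poly_coeff_tendsto:
  fixes P :: "nat \<Rightarrow> real poly" and p :: "complex \<Rightarrow> complex"
  assumes lim: "uniform_limit (ball 0 1) (\<lambda>n w. poly (map_poly of_real (P n)) w) p sequentially"
    and p: "\<And>w. (\<lambda>k. B k * w ^ k) sums p w"
  shows "(\<lambda>n. coeff (P n) k) \<longlonglongrightarrow> Re (B k)" "B k = of_real (Re (B k))"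
proof -
  define g where "g = (\<lambda>n w. poly (map_poly of_real (P n)) (w :: complex))"
  have g_sums: "(\<lambda>i. of_real (coeff (P n) i) * w ^ i) sums g n w" for n w
  proof -
    have "(\<lambda>i. of_real (coeff (P n) i) * w ^ i) sums (\<Sum>i\<le>degree (P n). of_real (coeff (P n) i) * w ^ i)"
      by (rule sums_finite) (auto simp: coeff_eq_0)
    then show ?thesis by (simp add: g_def poly_altdef degree_map_poly coeff_map_poly)
  qed
  from higher_deriv_power_series_0[OF g_sums] have d: "(deriv ^^ k) (g n) 0 = fact k * of_real (coeff (P n) k)" for n .
  have "(\<lambda>n. (deriv ^^ k) (g n) 0) \<longlonglongrightarrow> (deriv ^^ k) p 0"
    using lim unfolding g_def[symmetric]
  proof (rule higher_deriv_complex_uniform_limit)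
    show "\<forall>\<^sub>F n in sequentially. g n holomorphic_on ball 0 1"
      by (intro always_eventually allI holomorphic_on_subset[OF entire_power_series[OF g_sums]]) auto
  qed auto
  then have "(\<lambda>n. fact k * of_real (coeff (P n) k)) \<longlonglongrightarrow> fact k * B k"
    by (simp add: d higher_deriv_power_series_0[OF p])
  from tendsto_mult[OF tendsto_const[of "inverse (fact k)"] this]
  have L: "(\<lambda>n. complex_of_real (coeff (P n) k)) \<longlonglongrightarrow> B k" by (simp add: field_simps)
  from tendsto_Re[OF L] show "(\<lambda>n. coeff (P n) k) \<longlonglongrightarrow> Re (B k)" by simp
  from tendsto_Im[OF L] have "(\<lambda>n. 0) \<longlonglongrightarrow> Im (B k)" by simp
  then have "Im (B k) = 0" by (simp add: LIMSEQ_const_iff)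
  then show "B k = of_real (Re (B k))" by (simp add: complex_eq_iff)
qed

lemma logderiv_tendsto:
  fixes p :: "complex \<Rightarrow> complex" and a :: "'a \<Rightarrow> complex"
  assumes lim: "uniform_limit A (\<lambda>n w. \<Prod>y\<in>S n. (1 + w * a y) ^ m y) p sequentially"
    and A: "open A" "z \<in> A" and nz: "p z \<noteq> 0" "\<And>n y. y \<in> S n \<Longrightarrow> 1 + z * a y \<noteq> 0"
  shows "(\<lambda>n. \<Sum>y\<in>S n. of_nat (m y) * (a y / (1 + z * a y))) \<longlonglongrightarrow> deriv p z / p z"
proof -
  define g where "g = (\<lambda>n w. \<Prod>y\<in>S n. (1 + w * a y) ^ m y)"
  have prod_deriv: "((\<lambda>w. \<Prod>y\<in>T. (1 + w * a y) ^ m y) has_field_derivative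
      (\<Prod>y\<in>T. (1 + z * a y) ^ m y) * (\<Sum>y\<in>T. of_nat (m y) * (a y / (1 + z * a y)))) (at z)"
    if "\<And>y. y \<in> T \<Longrightarrow> 1 + z * a y \<noteq> 0" for T
    using that
  proof (induction T rule: infinite_finite_induct)
    case (insert y T)
    have y: "1 + z * a y \<noteq> 0" using insert.prems by simp
    have "((\<lambda>w. (1 + w * a y) ^ m y) has_field_derivative
        (1 + z * a y) ^ m y * (of_nat (m y) * (a y / (1 + z * a y)))) (at z)"
    proof -
      have "((\<lambda>w. 1 + w * a y) has_field_derivative a y) (at z)"
        by (auto intro!: derivative_eq_intros)
      from DERIV_power[OF this, of "m y"]
      have "((\<lambda>w. (1 + w * a y) ^ m y) has_field_derivative
          of_nat (m y) * (a y * (1 + z * a y) ^ (m y - Suc 0))) (at z)" by simp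
      moreover have "of_nat (m y) * (a y * (1 + z * a y) ^ (m y - Suc 0))
          = (1 + z * a y) ^ m y * (of_nat (m y) * (a y / (1 + z * a y)))"
        using y by (cases "m y") (auto simp: field_simps)
      ultimately show ?thesis by simp
    qed
    from DERIV_mult[OF this insert.IH] insert.prems insert.hyps show ?case
      by (simp add: algebra_simps)
  qed auto
  have "deriv (g n) z = g n z * (\<Sum>y\<in>S n. of_nat (m y) * (a y / (1 + z * a y)))" for n
    unfolding g_def by (rule DERIV_imp_deriv[OF prod_deriv]) (use nz in auto)
  moreover have "g n z \<noteq> 0" for n
    using nz(2) by (cases "finite (S n)") (auto simp: g_def)
  ultimately have "(\<Sum>y\<in>S n. of_nat (m y) * (a y / (1 + z * a y))) = deriv (g n) z / g n z" for n
    by (simp add: field_simps)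
  moreover have "(\<lambda>n. deriv (g n) z) \<longlonglongrightarrow> deriv p z"
    using lim unfolding g_def
    by (rule deriv_complex_uniform_limit) (use A in \<open>auto intro!: always_eventually holomorphic_intros\<close>)
  moreover have "(\<lambda>n. g n z) \<longlonglongrightarrow> p z"
    using tendsto_uniform_limitI[OF lim A(2)] by (simp add: g_def)
  ultimately show ?thesis using nz(1) by (simp add: tendsto_divide)
qed
lemma map_poly_of_real_linear_mult:
  "map_poly complex_of_real ([:1, a:] * P) = [:1, of_real a:] * map_poly of_real P"
  by (rule poly_eqI) (simp add: coeff_map_poly coeff_pCons split: nat.splits)

lemma poly_map_of_real_prod_linear:
  "poly (map_poly complex_of_real (\<Prod>y\<in>S. [:1, a y:] ^ m y)) w = (\<Prod>y\<in>S. (1 + w * of_real (a y)) ^ m y)"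
proof (induction S rule: infinite_finite_induct)
  case (insert y S)
  have "poly (map_poly complex_of_real ([:1, a y:] ^ k * P)) w =
      (1 + w * of_real (a y)) ^ k * poly (map_poly of_real P) w" for k P
    by (induction k) (simp_all add: mult.assoc map_poly_of_real_linear_mult del: mult_pCons_left)
  then show ?case using insert by simp
qed auto

text \<open>Here the pieces meet. The function \<open>\<mu>(r) = r\<^sup>2 p'(r\<^sup>2) / p(r\<^sup>2)\<close> is on the one hand an average of the
counting function of \<open>Y\<close>, on the other hand the mean of the weights \<open>\<beta>\<^sub>k r\<^sup>2\<^sup>k\<close>. The constant \<open>n0\<close>
accounts for roots counted by \<open>U\<close> at the origin; it is absorbed by the bounded errors.\<close>

lemma coefficient_ratio_asymptotics:
  fixes Y :: "real set" and m :: "real \<Rightarrow> nat" and p :: "complex \<Rightarrow> complex" and U :: "real \<Rightarrow> real"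
  assumes Ypos: "\<And>y. y \<in> Y \<Longrightarrow> y > 0" and fin: "\<And>s. finite {y\<in>Y. y \<le> s}"
    and prod: "\<And>r. uniform_limit (cball 0 r)
      (\<lambda>n w. \<Prod>y | y \<in> Y \<and> y \<le> sqrt (real n). (1 + w * of_real (1 / y\<^sup>2)) ^ m y) p sequentially"
    and ps: "\<And>w. (\<lambda>k. B k * w ^ k) sums p w" and p0: "p 0 = 1"
    and U: "regularly_varying U \<alpha>" and \<alpha>: "\<alpha> < 2"
    and U_count: "\<And>r. r \<ge> 0 \<Longrightarrow> U r = real n0 + (\<Sum>y | y \<in> Y \<and> y \<le> r. real (m y))"
  obtains \<beta> where "\<And>k. B k = of_real (\<beta> k)" "\<And>k. \<beta> k > 0"
    "filterlim (\<lambda>n. sqrt (\<beta> n / \<beta> (Suc n))) at_top sequentially"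
    "(\<lambda>n. U (sqrt (\<beta> n / \<beta> (Suc n))) / real n) \<longlonglongrightarrow> 1 / ((pi * \<alpha> / 2) / sin (pi * \<alpha> / 2))"
proof -
  interpret regularly_varying U \<alpha> by (rule U)
  define \<beta> where "\<beta> = (\<lambda>k. Re (B k))"
  define S where "S = (\<lambda>n. {y. y \<in> Y \<and> y \<le> sqrt (real n)})"
  define P where "P = (\<lambda>n. \<Prod>y\<in>S n. [:1, 1 / y\<^sup>2:] ^ m y)"
  have lim: "uniform_limit (cball 0 r) (\<lambda>n w. \<Prod>y\<in>S n. (1 + w * of_real (1 / y\<^sup>2)) ^ m y) p sequentially" for r
    using prod unfolding S_def .
  have "uniform_limit (ball 0 1) (\<lambda>n w. poly (map_poly of_real (P n)) w) p sequentially"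
    unfolding P_def poly_map_of_real_prod_linear by (rule uniform_limit_on_subset[OF lim[of 1]]) auto
  note coeffs = poly_coeff_tendsto[OF this ps]
  have B: "B k = of_real (\<beta> k)" for k using coeffs(2) by (simp add: \<beta>_def)
  have lc: "log_concave_seq \<beta>" unfolding \<beta>_def
    by (rule log_concave_limit[OF _ coeffs(1)]) (auto simp: P_def intro!: log_concave_prod_linear)
  then have nn: "\<beta> k \<ge> 0" for k by (simp add: log_concave_seq_def)
  have "B 0 = 1" using sums_unique2[OF ps[of 0] powser_sums_zero] p0 by simp
  then have \<beta>0: "\<beta> 0 = 1" by (simp add: \<beta>_def)

  define s0 where "s0 = (\<lambda>x. Re (p (of_real x)))"
  define s1 where "s1 = (\<lambda>x. Re (of_real x * deriv p (of_real x)))"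
  have sum0: "(\<lambda>k. \<beta> k * x ^ k) sums s0 x" for x
    using sums_Re[OF ps[of "of_real x"]] unfolding s0_def B by simp
  have sum1: "(\<lambda>k. real k * \<beta> k * x ^ k) sums s1 x" for x
    using sums_Re[OF power_series_Euler_derivative[OF ps, of "of_real x"]] unfolding s1_def B by simp
  have p_real: "p (of_real x) = of_real (s0 x)" for x
  proof (rule sums_unique2[OF ps])
    show "(\<lambda>k. B k * of_real x ^ k) sums of_real (s0 x)"
      using sums_of_real[OF sum0[of x]] unfolding B by simp
  qed
  have d_real: "of_real x * deriv p (of_real x) = of_real (s1 x)" for x
  proof (rule sums_unique2[OF power_series_Euler_derivative[OF ps]])
    show "(\<lambda>k. of_nat k * B k * of_real x ^ k) sums of_real (s1 x)"
      using sums_of_real[OF sum1[of x]] unfolding B by simp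
  qed
  have s0_pos: "s0 x > 0" if "x \<ge> 0" for x
  proof -
    have "(\<Sum>k\<in>{0}. \<beta> k * x ^ k) \<le> (\<Sum>k. \<beta> k * x ^ k)"
      using that nn sum0[of x] by (intro sum_le_suminf) (auto intro: sums_summable)
    then show ?thesis using \<beta>0 sum0[of x] by (simp add: sums_iff)
  qed
  define \<mu> where "\<mu> = (\<lambda>r. s1 (r\<^sup>2) / s0 (r\<^sup>2))"
  have \<mu>_int: "has_bochner_integral (lebesgue_on {0<..<1})
      (\<lambda>t. \<Sum>y | y \<in> Y \<and> y \<le> r * sqrt (t / (1 - t)). real (m y)) (\<mu> r)" if r: "r > 0" for r
  proof (rule Stieltjes_sum_eq_integral[OF r Ypos fin])
    define z where "z = complex_of_real (r\<^sup>2)"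
    have zpos: "1 + r\<^sup>2 * (1 / y\<^sup>2) > 0" for y by (simp add: add_pos_nonneg)
    have "(\<lambda>n. \<Sum>y\<in>S n. of_nat (m y) * (of_real (1 / y\<^sup>2) / (1 + z * of_real (1 / y\<^sup>2)))) \<longlonglongrightarrow> deriv p z / p z"
    proof (rule logderiv_tendsto)
      show "uniform_limit (ball 0 (r\<^sup>2 + 1)) (\<lambda>n w. \<Prod>y\<in>S n. (1 + w * of_real (1 / y\<^sup>2)) ^ m y) p sequentially"
        by (rule uniform_limit_on_subset[OF lim[of "r\<^sup>2 + 1"]]) auto
      show "z \<in> ball 0 (r\<^sup>2 + 1)" by (simp add: z_def norm_power)
      show "p z \<noteq> 0" using s0_pos[of "r\<^sup>2"] unfolding z_def p_real by simp
      show "1 + z * of_real (1 / y\<^sup>2) \<noteq> 0" for y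
      proof -
        have "1 + z * of_real (1 / y\<^sup>2) = of_real (1 + r\<^sup>2 * (1 / y\<^sup>2))" by (simp add: z_def norm_power)
        then show ?thesis using zpos[of y] by (metis of_real_eq_0_iff less_irrefl)
      qed
    qed auto
    then have "(\<lambda>n. z * (\<Sum>y\<in>S n. of_nat (m y) * (of_real (1 / y\<^sup>2) / (1 + z * of_real (1 / y\<^sup>2)))))
        \<longlonglongrightarrow> z * (deriv p z / p z)" by (rule tendsto_mult_left)
    moreover have "z * (deriv p z / p z) = of_real (\<mu> r)"
      using d_real[of "r\<^sup>2"] p_real[of "r\<^sup>2"] by (simp add: \<mu>_def z_def)
    moreover have "z * (\<Sum>y\<in>S n. of_nat (m y) * (of_real (1 / y\<^sup>2) / (1 + z * of_real (1 / y\<^sup>2))))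
        = of_real (\<Sum>y\<in>S n. real (m y) * (r\<^sup>2 / (r\<^sup>2 + y\<^sup>2)))" for n
    proof -
      have "z * (of_nat (m y) * (of_real (1 / y\<^sup>2) / (1 + z * of_real (1 / y\<^sup>2))))
          = of_real (real (m y) * (r\<^sup>2 / (r\<^sup>2 + y\<^sup>2)))" if "y \<in> S n" for y
      proof -
        have y: "y > 0" using that Ypos by (simp add: S_def)
        have "r\<^sup>2 + y\<^sup>2 \<noteq> 0" using r by (simp add: sum_power2_eq_zero_iff)
        then have "r\<^sup>2 * (real (m y) * ((1 / y\<^sup>2) / (1 + r\<^sup>2 * (1 / y\<^sup>2)))) = real (m y) * (r\<^sup>2 / (r\<^sup>2 + y\<^sup>2))"
          using y by (simp add: divide_simps add_ac)
        from arg_cong[OF this, of complex_of_real] show ?thesis by (simp add: z_def norm_power)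
      qed
      then show ?thesis unfolding sum_distrib_left of_real_sum by (intro sum.cong) auto
    qed
    ultimately have "(\<lambda>n. complex_of_real (\<Sum>y\<in>S n. real (m y) * (r\<^sup>2 / (r\<^sup>2 + y\<^sup>2)))) \<longlonglongrightarrow> of_real (\<mu> r)"
      by simp
    then show "(\<lambda>n. \<Sum>y | y \<in> Y \<and> y \<le> sqrt (real n). real (m y) * (r\<^sup>2 / (r\<^sup>2 + y\<^sup>2))) \<longlonglongrightarrow> \<mu> r"
      unfolding tendsto_of_real_iff S_def .
  qed auto
  define M where "M = (\<lambda>r. real n0 + \<mu> r)"
  have M_int: "has_bochner_integral (lebesgue_on {0<..<1}) (\<lambda>t. U (r * sqrt (t / (1 - t)))) (M r)" if r: "r > 0" for r
  proof -
    have "has_bochner_integral (lebesgue_on {0<..<1::real}) (\<lambda>t. real n0) (real n0)"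
    proof -
      have "integrable (lebesgue_on {0<..<1::real}) (\<lambda>t. real n0)"
        by (intro finite_measure.integrable_const finite_measure_lebesgue_on) auto
      then show ?thesis by (simp add: has_bochner_integral_iff measure_restrict_space)
    qed
    from has_bochner_integral_add[OF this \<mu>_int[OF r]]
    have "has_bochner_integral (lebesgue_on {0<..<1})
       (\<lambda>t. real n0 + (\<Sum>y | y \<in> Y \<and> y \<le> r * sqrt (t / (1 - t)). real (m y))) (M r)" by (simp add: M_def)
    then show ?thesis
      by (rule has_bochner_integral_cong[THEN iffD1, rotated -1]) (use r in \<open>auto simp: U_count\<close>)
  qed
  define C where "C = (pi * \<alpha> / 2) / sin (pi * \<alpha> / 2)"
  have Cpos: "C > 0" unfolding C_def using index_pos \<alpha> by (intro divide_pos_pos sin_gt_zero) auto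
  have MU: "((\<lambda>r. M r / U r) \<longlongrightarrow> C) at_top"
  proof (rule Lim_transform_eventually)
    show "((\<lambda>r. (\<integral>t. U (r * sqrt (t / (1 - t))) \<partial>lebesgue_on {0<..<1}) / U r) \<longlongrightarrow> C) at_top"
      unfolding C_def by (rule Stieltjes_average[OF \<alpha>])
    show "\<forall>\<^sub>F r in at_top. (\<integral>t. U (r * sqrt (t / (1 - t))) \<partial>lebesgue_on {0<..<1}) / U r = M r / U r"
      using eventually_gt_at_top[of 0]
      by eventually_elim (use M_int in \<open>simp add: has_bochner_integral_integral_eq\<close>)
  qed
  have M_mono: "M r \<le> M s" if "0 < r" "r \<le> s" for r s
  proof -
    have "s > 0" using that by simp
    have "(\<integral>t. U (r * sqrt (t / (1 - t))) \<partial>lebesgue_on {0<..<1})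
        \<le> (\<integral>t. U (s * sqrt (t / (1 - t))) \<partial>lebesgue_on {0<..<1})"
      using M_int[OF that(1)] M_int[OF \<open>s > 0\<close>] that
      by (intro integral_mono) (auto simp: has_bochner_integral_iff intro!: mono mult_right_mono)
    then show ?thesis
      using M_int[OF that(1)] M_int[OF \<open>s > 0\<close>] by (simp add: has_bochner_integral_iff)
  qed
  have M_top: "filterlim M at_top at_top"
  proof -
    have "filterlim (\<lambda>r. (M r / U r) * U r) at_top at_top"
      using filterlim_tendsto_pos_mult_at_top[OF MU Cpos tendsto_infinity] .
    moreover have "\<forall>\<^sub>F r in at_top. (M r / U r) * U r = M r"
      using eventually_pos by eventually_elim simp
    ultimately show ?thesis by (simp add: filterlim_cong)
  qed
  \<comment> \<open>A vanishing coefficient would make all later ones vanish by log-concavity. Then \<open>\<mu>\<close> would be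
    bounded by the degree of the remaining polynomial, whereas it is unbounded.\<close>
  have pos: "\<beta> k > 0" for k
  proof (induction k)
    case (Suc n)
    show ?case
    proof (rule ccontr)
      assume "\<not> \<beta> (Suc n) > 0"
      then have z: "\<beta> (Suc n) = 0" using nn[of "Suc n"] by simp
      have "s1 x \<le> real n * s0 x" if "x > 0" for x
      proof (rule sums_le[OF _ sum1 sums_mult[OF sum0]])
        fix k show "real k * \<beta> k * x ^ k \<le> real n * (\<beta> k * x ^ k)"
        proof (cases "k \<le> n")
          case True
          then show ?thesis using nn[of k] that by (simp add: mult.assoc mult_right_mono)
        next
          case False
          then show ?thesis using log_concave_zero_tail[OF lc Suc z, of k] by simp
        qed
      qed
      then have "M r \<le> real n0 + real n" if "r > 0" for r
        using s0_pos[of "r\<^sup>2"] that by (simp add: M_def \<mu>_def divide_le_eq)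
      moreover have "\<forall>\<^sub>F r in at_top. M r > real n0 + real n"
        using M_top by (simp add: filterlim_at_top_dense)
      then have "\<forall>\<^sub>F r in at_top. r > 0 \<and> M r > real n0 + real n"
        using eventually_gt_at_top[of 0] by eventually_elim simp
      from eventually_happens[OF this] obtain r where "r > 0" "M r > real n0 + real n" by auto
      ultimately show False by force
    qed
  qed (simp add: \<beta>0)
  define y where "y = (\<lambda>n. sqrt (\<beta> n / \<beta> (Suc n)))"
  \<comment> \<open>The mean value bounds are used with \<open>s = \<sigma>\<^sup>2\<close>, because the argument of \<open>p\<close> is the square of the radius.\<close>
  define K where "K = (\<lambda>\<sigma>::real. 1 / (1 - 1 / \<sigma>\<^sup>2)\<^sup>2 + real n0)"
  have ypos: "y n > 0" for n unfolding y_def using pos by simp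
  have y2: "(y n)\<^sup>2 = \<beta> n / \<beta> (Suc n)" for n unfolding y_def using less_imp_le[OF pos] by simp
  have upper: "M (y n / \<sigma>) \<le> real n + K \<sigma>" if \<sigma>: "\<sigma> > 1" for \<sigma> n
  proof -
    define x where "x = (y n / \<sigma>)\<^sup>2"
    have x: "x > 0" using ypos[of n] \<sigma> by (simp add: x_def)
    have "\<sigma>\<^sup>2 > 1" using \<sigma> by (simp add: one_less_power)
    have "s1 x \<le> (real n + 1 / (1 - 1 / \<sigma>\<^sup>2)\<^sup>2) * s0 x"
    proof (rule mean_le_of_ratio[OF lc pos x \<open>\<sigma>\<^sup>2 > 1\<close> sum0 sum1])
      show "\<beta> (Suc n) * (x * \<sigma>\<^sup>2) \<le> \<beta> n"
        using pos[of "Suc n"] \<sigma> by (simp add: x_def power_divide y2)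
    qed
    then show ?thesis using s0_pos[of x] x by (simp add: M_def \<mu>_def K_def x_def[symmetric] divide_le_eq)
  qed
  have lower: "M (y n * \<sigma>) \<ge> real n - K \<sigma>" if \<sigma>: "\<sigma> > 1" for \<sigma> n
  proof -
    define x where "x = (y n * \<sigma>)\<^sup>2"
    have x: "x > 0" using ypos[of n] \<sigma> by (simp add: x_def)
    have "\<sigma>\<^sup>2 > 1" using \<sigma> by (simp add: one_less_power)
    have "(real n - 1 / (1 - 1 / \<sigma>\<^sup>2)\<^sup>2) * s0 x \<le> s1 x"
    proof (rule mean_ge_of_ratio[OF lc pos x \<open>\<sigma>\<^sup>2 > 1\<close> sum0 sum1])
      show "\<sigma>\<^sup>2 * \<beta> n \<le> \<beta> (Suc n) * x"
        using pos[of "Suc n"] \<sigma> by (simp add: x_def power_mult_distrib y2)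
    qed
    then have "real n - 1 / (1 - 1 / \<sigma>\<^sup>2)\<^sup>2 \<le> \<mu> (y n * \<sigma>)"
      using s0_pos[of x] x by (simp add: \<mu>_def x_def[symmetric] le_divide_eq)
    then show ?thesis unfolding M_def K_def by simp
  qed
  note * = count_at_saddle_point[where y = y and M = M and C = C and K = K, OF Cpos MU M_mono ypos upper lower]
  show ?thesis
    by (rule that[OF B pos]) (use * in \<open>simp_all add: y_def C_def\<close>)
qed

section \<open>Counting roots on the real axis\<close>

lemma finite_nonneg_real_zeros:
  assumes "f holomorphic_on UNIV" "f z0 \<noteq> 0"
  shows "finite {x. 0 \<le> x \<and> x \<le> r \<and> f (of_real x) = 0}"
proof -
  have "finite (of_real -` {z. f z = 0 \<and> norm z \<le> r} :: real set)"
    by (rule finite_vimageI[OF entire_finite_zeros[OF assms] inj_of_real])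
  then show ?thesis by (rule finite_subset[rotated]) auto
qed

lemma n_plus_mono:
  assumes "f holomorphic_on UNIV" "f z0 \<noteq> 0" "r \<le> s"
  shows "n_plus f r \<le> n_plus f s"
  unfolding n_plus_def using assms(3)
  by (intro sum_mono2 finite_nonneg_real_zeros[OF assms(1,2)]) auto

text \<open>A root at the origin contributes the same constant for every radius; the remaining sum runs over the
roots that reappear as zeros of the Hadamard product.\<close>

lemma n_plus_split:
  assumes "f holomorphic_on UNIV" "f z0 \<noteq> 0" "r \<ge> 0"
  shows "n_plus f r = (if f 0 = 0 then nat (zorder f 0) else 0) +
    (\<Sum>y | y \<in> {y. 0 < y \<and> f (of_real y) = 0} \<and> y \<le> r. nat (zorder f (of_real y)))"
proof -
  define S where "S = {y. y \<in> {y. 0 < y \<and> f (of_real y) = 0} \<and> y \<le> r}"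
  have "finite S" unfolding S_def
    by (rule finite_subset[OF _ finite_nonneg_real_zeros[OF assms(1,2), of r]]) auto
  have "{x. 0 \<le> x \<and> x \<le> r \<and> f (of_real x) = 0} = (if f 0 = 0 then {0} else {}) \<union> S"
    using assms(3) by (auto simp: S_def less_le)
  moreover have "(if f 0 = 0 then {0} else {}) \<inter> S = {}" by (auto simp: S_def)
  ultimately have "n_plus f r = (\<Sum>x\<in>(if f 0 = 0 then {0} else {}). nat (zorder f (of_real x)))
      + (\<Sum>x\<in>S. nat (zorder f (of_real x)))"
    unfolding n_plus_def using \<open>finite S\<close> by (simp add: sum.union_disjoint)
  then show ?thesis by (simp add: S_def)
qed

section \<open>Jensen polynomials of the cosine\<close>

text \<open>Both sides are multiplied by \<open>4 (k + j + 1) (k + j + 1/2) = (2k + 2j + 2) (2k + 2j + 1)\<close> when \<open>j\<close> is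
increased by one.\<close>

lemma falling_factorial_half_integer:
  "falling_factorial (of_nat (k + j) - 1 / 2 :: complex) j * 4 ^ j * fact (k + j) * fact (2 * k)
     = fact (2 * (k + j)) * fact k"
proof (induction j)
  case 0
  show ?case by (simp add: falling_factorial_def)
next
  case (Suc j)
  have ff: "falling_factorial (x + 1) (Suc j) = (x + 1) * falling_factorial x j" for x :: complex
  proof -
    have "falling_factorial (x + 1) (Suc j) = (\<Prod>i\<in>{Suc 0..Suc j}. x + 1 - of_nat i + 1)"
      by (simp add: falling_factorial_def)
    also have "\<dots> = (x + 1) * (\<Prod>i\<in>{Suc (Suc 0)..Suc j}. x + 1 - of_nat i + 1)"
      by (subst prod.atLeast_Suc_atMost) auto
    also have "(\<Prod>i\<in>{Suc (Suc 0)..Suc j}. x + 1 - of_nat i + 1) = (\<Prod>i\<in>{Suc 0..j}. x - of_nat i + 1)"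
      by (subst prod.shift_bounds_cl_Suc_ivl) (simp add: algebra_simps)
    finally show ?thesis by (simp add: falling_factorial_def)
  qed
  define x where "x = (of_nat (k + j) - 1 / 2 :: complex)"
  have x1: "of_nat (k + Suc j) - 1 / 2 = x + 1" by (simp add: x_def)
  have "fact (2 * (k + Suc j)) = (of_nat (2 * (k + j) + 2) * of_nat (2 * (k + j) + 1) * fact (2 * (k + j)) :: complex)"
    by (simp add: algebra_simps)
  also have "\<dots> = 4 * (of_nat (k + j) + 1) * (x + 1) * fact (2 * (k + j))"
    by (simp add: x_def algebra_simps)
  finally have f2: "fact (2 * (k + Suc j)) = 4 * (of_nat (k + j) + 1) * (x + 1) * (fact (2 * (k + j)) :: complex)" .
  have f1: "fact (k + Suc j) = (of_nat (k + j) + 1) * (fact (k + j) :: complex)"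
    by (simp add: algebra_simps)
  define F where "F = falling_factorial x j"
  have "(x + 1) * F * 4 ^ Suc j * ((of_nat (k + j) + 1) * fact (k + j)) * fact (2 * k)
      = 4 * (of_nat (k + j) + 1) * (x + 1) * (F * 4 ^ j * fact (k + j) * fact (2 * k))"
    by (simp only: power_Suc mult_ac)
  also have "F * 4 ^ j * fact (k + j) * fact (2 * k) = fact (2 * (k + j)) * fact k"
    using Suc by (simp only: x_def F_def)
  finally show ?case unfolding x1 ff f1 f2 F_def by (simp only: mult_ac)
qed

lemma jensen_coeff_cos: "jensen_coeff cos k = (-1) ^ k * fact k / fact (2 * k)"
proof -
  have "(\<lambda>x::complex. cos (1 * x)) has_fps_expansion fps_cos 1" by (rule has_fps_expansion_cos)
  then have "fps_nth (fps_cos 1) (2 * k) = (deriv ^^ (2 * k)) cos (0::complex) / fact (2 * k)"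
    by (intro fps_nth_fps_expansion) simp
  then show ?thesis by (simp add: jensen_coeff_def fps_cos_def)
qed

lemma even_jensen_poly_cos:
  "even_jensen_poly d cos =
     smult (4 ^ d * ((fact d)\<^sup>2 / fact (2 * d)))
       (pcompose (laguerre_poly (- 1 / 2) d) [:0, 1 / 4:])"
proof (rule poly_eqI)
  fix k
  have L: "coeff (laguerre_poly (- 1 / 2 :: complex) d) k = (if k \<le> d then (-1) ^ k *
     falling_factorial (of_nat d + - 1 / 2) (d - k) / (fact k * fact (d - k)) else 0)"
    unfolding laguerre_poly_def by (simp add: coeff_sum)
  have J: "coeff (even_jensen_poly d cos) k = (if k \<le> d then of_nat (d choose k) * jensen_coeff cos k else 0)"
    unfolding even_jensen_poly_def by (simp add: coeff_sum)
  show "coeff (even_jensen_poly d cos) k = coeff (smult (4 ^ d * ((fact d)\<^sup>2 / fact (2 * d)))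
       (pcompose (laguerre_poly (- 1 / 2) d) [:0, 1 / 4:])) k"
  proof (cases "k \<le> d")
    case True
    then obtain j where d: "d = k + j" by (metis le_iff_add)
    define F where "F = falling_factorial (of_nat d - 1 / 2 :: complex) j"
    have F: "F = fact (2 * d) * fact k / (4 ^ j * fact d * fact (2 * k))"
      using falling_factorial_half_integer[of k j] by (simp add: F_def d field_simps)
    have ch: "of_nat (d choose k) = (fact d / (fact k * fact j) :: complex)"
      by (subst binomial_fact) (simp_all add: d)
    have "coeff (smult (4 ^ d * ((fact d)\<^sup>2 / fact (2 * d))) (pcompose (laguerre_poly (- 1 / 2) d) [:0, 1 / 4:])) k
      = 4 ^ d * ((fact d)\<^sup>2 / fact (2 * d)) * ((1 / 4) ^ k * ((-1) ^ k * F / (fact k * fact j)))"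
      using True unfolding coeff_smult coeff_pcompose_linear L F_def by (simp add: d)
    also have "\<dots> = of_nat (d choose k) * jensen_coeff cos k"
      unfolding F ch jensen_coeff_cos
      by (simp add: d power_add power_divide power2_eq_square field_simps)
    finally show ?thesis using True by (simp add: J)
  next
    case False
    then show ?thesis unfolding coeff_smult coeff_pcompose_linear L J by simp
  qed
qed

section \<open>Scaling limit of the Jensen polynomials\<close>

text \<open>One step of the ratio is \<open>-(2n + 1)(2n + 2) / y\<^sub>n\<^sup>2\<close>, and \<open>a\<^sub>n\<close> is \<open>(y\<^sub>n / 2n)\<^sup>2\<close> up to a factor tending to \<open>1\<close>.
Since the generalised inverse of \<open>n\<^sub>+\<close> is asymptotic to each shift of \<open>y\<close>, the same holds for the
steps starting at \<open>n + j\<close>, and \<open>k\<close> such steps are multiplied.\<close>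

lemma gamma_ratio_asymptotics:
  fixes f :: "complex \<Rightarrow> complex" and \<gamma> :: "nat \<Rightarrow> complex"
  assumes hol: "f holomorphic_on UNIV" and order: "entire_order f < 2"
    and real_roots: "\<And>z. f z = 0 \<Longrightarrow> z \<in> \<real>"
    and series: "\<And>z. (\<lambda>k. \<gamma> (2 * k) * z ^ (2 * k) / fact (2 * k)) sums f z"
    and alpha: "0 < \<alpha>" "\<alpha> < 2"
    and regular_variation:
      "\<And>x::real. x > 0 \<Longrightarrow>
         ((\<lambda>r. real (n_plus f (x * r)) / real (n_plus f r)) \<longlongrightarrow> x powr \<alpha>) at_top"
  shows "(\<lambda>n. \<gamma> (2 * (n + k)) / \<gamma> (2 * n) * of_real (scale_seq f \<alpha> n) ^ k) \<longlonglongrightarrow> (-1) ^ k"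
proof -
  \<comment> \<open>For \<open>f = 0\<close> the root count is a sum over an infinite set, hence \<open>0\<close>, and the quotients in the
    hypothesis are \<open>0 / 0 = 0\<close>, which does not tend to \<open>1\<close>.\<close>
  have "\<exists>z0. f z0 \<noteq> 0"
  proof (rule ccontr)
    assume "\<nexists>z0. f z0 \<noteq> 0"
    then have z: "f z = 0" for z by blast
    have "\<forall>\<^sub>F r in at_top. real (n_plus f (1 * r)) / real (n_plus f r) = 0"
      using eventually_gt_at_top[of 0]
    proof eventually_elim
      case (elim r)
      have "infinite {0..r}" using elim by simp
      then show ?case by (simp add: n_plus_def z flip: atLeastAtMost_iff)
    qed
    then have "((\<lambda>r. real (n_plus f (1 * r)) / real (n_plus f r)) \<longlongrightarrow> 0) at_top" by (rule tendsto_eventually)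
    with regular_variation[of 1] have "(1::real) powr \<alpha> = 0"
      by (intro tendsto_unique[of at_top]) auto
    then show False by simp
  qed
  then obtain z0 where nz: "f z0 \<noteq> 0" by blast
  define b where "b = (\<lambda>k. \<gamma> (2 * k) / fact (2 * k))"
  let ?Y = "{y::real. 0 < y \<and> f (of_real y) = 0}"
  let ?mult = "\<lambda>y::real. nat (zorder f (of_real y))"
  define U where "U = (\<lambda>r. real (n_plus f r))"
  define C where "C = (pi * \<alpha> / 2) / sin (pi * \<alpha> / 2)"
  have C: "C > 0" unfolding C_def using alpha by (intro divide_pos_pos sin_gt_zero) auto
  have series': "(\<lambda>k. b k * z ^ (2 * k)) sums f z" for z
    using series[of z] by (simp add: b_def)
  obtain k0 p where c: "b k0 \<noteq> 0" and p0: "p 0 = 1"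
    and ps: "\<And>w. (\<lambda>k. (-1) ^ k * b (k + k0) / b k0 * w ^ k) sums p w"
    and prod: "\<And>r. uniform_limit (cball 0 r) (\<lambda>n w. \<Prod>y | y \<in> ?Y \<and> y \<le> sqrt (real n).
        (1 + w * of_real (1 / y\<^sup>2)) ^ ?mult y) p sequentially"
    by (rule even_Hadamard_product[OF series' nz order real_roots]) (assumption | rule that)+
  interpret regularly_varying U \<alpha>
    by unfold_locales
      (use n_plus_mono[OF hol nz] alpha regular_variation in \<open>auto simp: U_def\<close>)
  have finY: "finite {y\<in>?Y. y \<le> s}" for s
    by (rule finite_subset[OF _ finite_nonneg_real_zeros[OF hol nz, of s]]) auto
  obtain \<beta> where B: "\<And>k. (-1) ^ k * b (k + k0) / b k0 = of_real (\<beta> k)" and pos: "\<And>k. \<beta> k > 0"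
    and top: "filterlim (\<lambda>n. sqrt (\<beta> n / \<beta> (Suc n))) at_top sequentially"
    and count: "(\<lambda>n. U (sqrt (\<beta> n / \<beta> (Suc n))) / real n) \<longlonglongrightarrow> 1 / C"
    unfolding C_def
    by (rule coefficient_ratio_asymptotics[OF _ finY prod ps p0 regularly_varying_axioms alpha(2),
          where ?n0.0 = "if f 0 = 0 then nat (zorder f 0) else 0"])
       (auto simp: U_def n_plus_split[OF hol nz])
  define y where "y = (\<lambda>n. sqrt (\<beta> n / \<beta> (Suc n)))"
  have ypos: "y n > 0" for n unfolding y_def using pos by simp
  have y2: "(y n)\<^sup>2 = \<beta> n / \<beta> (Suc n)" for n unfolding y_def using less_imp_le[OF pos] by simp
  define \<rho> where "\<rho> = (\<lambda>n. Inf {r. r > 0 \<and> U r \<ge> real n / C})"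
  have scale: "scale_seq f \<alpha> n = (\<rho> n / (2 * real n))\<^sup>2" for n
  proof -
    have "2 * real n / (pi * \<alpha> * (1 / sin (pi * \<alpha> / 2))) = real n / C" by (simp add: C_def)
    then show ?thesis by (simp add: scale_seq_def n_plus_inv_def \<rho>_def U_def)
  qed
  have \<rho>_lim: "(\<lambda>n. \<rho> (n + k0) / y (n + j)) \<longlonglongrightarrow> 1" for j
    unfolding \<rho>_def
  proof (rule generalized_inverse_asymptotics[OF C])
    show "filterlim (\<lambda>n. y (n + j)) at_top sequentially"
      using top unfolding y_def[symmetric] by (rule filterlim_compose) (rule filterlim_add_const_nat_at_top)
    show "\<forall>\<^sub>F n in sequentially. 0 < real (n + k0)" by real_asymp
    have "(\<lambda>n. U (y (n + j)) / real (n + j) * (real (n + j) / real (n + k0))) \<longlonglongrightarrow> 1 / C * 1"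
    proof (rule tendsto_mult)
      show "(\<lambda>n. U (y (n + j)) / real (n + j)) \<longlonglongrightarrow> 1 / C"
        using LIMSEQ_ignore_initial_segment[OF count, of j] unfolding y_def by simp
      show "(\<lambda>n. real (n + j) / real (n + k0)) \<longlonglongrightarrow> 1" by real_asymp
    qed
    moreover have "\<forall>\<^sub>F n in sequentially. U (y (n + j)) / real (n + j) * (real (n + j) / real (n + k0))
        = U (y (n + j)) / real (n + k0)"
      using eventually_gt_at_top[of 0] by eventually_elim simp
    ultimately show "(\<lambda>n. U (y (n + j)) / real (n + k0)) \<longlonglongrightarrow> 1 / C"
      using Lim_transform_eventually by fastforce
  qed (use ypos in auto)
  have gam: "\<gamma> (2 * (m + k0)) = fact (2 * (m + k0)) * ((-1) ^ m * b k0 * of_real (\<beta> m))" for m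
  proof -
    have "(-1) ^ m * (-1) ^ m = (1 :: complex)" by (simp flip: power_add)
    then have "b (m + k0) = (-1) ^ m * b k0 * ((-1) ^ m * b (m + k0) / b k0)" using c by (simp add: field_simps)
    then have "b (m + k0) = (-1) ^ m * b k0 * of_real (\<beta> m)" unfolding B .
    then show ?thesis by (simp add: b_def field_simps)
  qed
  have gam_nz: "\<gamma> (2 * (m + k0)) \<noteq> 0" for m
    unfolding gam using c pos[of m] by simp
  define A where "A n = complex_of_real (scale_seq f \<alpha> n)" for n
  \<comment> \<open>The coefficient \<open>\<beta> m\<close> belongs to \<open>\<gamma>\<close> at \<open>2 (m + k0)\<close>, hence the shift by \<open>k0\<close> in all indices.\<close>
  have step: "(\<lambda>m. \<gamma> (2 * (Suc (m + j) + k0)) / \<gamma> (2 * (m + j + k0)) * A (m + k0)) \<longlonglongrightarrow> -1" for j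
  proof -
    define R where "R = (\<lambda>m. - ((2 * real (m + j + k0) + 2) * (2 * real (m + j + k0) + 1) / (2 * real (m + k0))\<^sup>2)
        * (\<rho> (m + k0) / y (m + j))\<^sup>2)"
    have "\<gamma> (2 * (Suc (m + j) + k0)) / \<gamma> (2 * (m + j + k0)) * A (m + k0) = of_real (R m)" for m
    proof -
      have "\<gamma> (2 * (Suc (m + j) + k0)) / \<gamma> (2 * (m + j + k0)) =
          of_real (- ((2 * real (m + j + k0) + 2) * (2 * real (m + j + k0) + 1)) * (\<beta> (Suc (m + j)) / \<beta> (m + j)))"
      proof -
        define N where "N = m + j + k0"
        have F: "fact (2 * (Suc (m + j) + k0)) = (of_real ((2 * real N + 2) * (2 * real N + 1)) * fact (2 * N) :: complex)"
          by (simp add: N_def algebra_simps)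
        show ?thesis unfolding gam unfolding F unfolding N_def[symmetric] using c pos[of "m + j"]
          by simp
      qed
      also have "\<beta> (Suc (m + j)) / \<beta> (m + j) = 1 / (y (m + j))\<^sup>2" by (simp add: y2)
      finally show ?thesis by (simp add: A_def scale R_def power_divide)
    qed
    moreover have "R \<longlonglongrightarrow> - 1 * 1\<^sup>2"
      unfolding R_def
    proof (intro tendsto_mult tendsto_power \<rho>_lim)
      show "(\<lambda>m. - ((2 * real (m + j + k0) + 2) * (2 * real (m + j + k0) + 1) / (2 * real (m + k0))\<^sup>2)) \<longlonglongrightarrow> - 1"
        by real_asymp
    qed
    then have "(\<lambda>m. complex_of_real (R m)) \<longlonglongrightarrow> of_real (- 1)" by (intro tendsto_of_real) simp
    ultimately show ?thesis by simp
  qed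
  have "(\<lambda>m. \<gamma> (2 * (m + k0 + k)) / \<gamma> (2 * (m + k0)) * A (m + k0) ^ k) \<longlonglongrightarrow> (-1) ^ k"
  proof (induction k)
    case 0
    then show ?case using gam_nz by simp
  next
    case (Suc k)
    have "(\<lambda>m. (\<gamma> (2 * (Suc (m + k) + k0)) / \<gamma> (2 * (m + k + k0)) * A (m + k0)) *
        (\<gamma> (2 * (m + k0 + k)) / \<gamma> (2 * (m + k0)) * A (m + k0) ^ k)) \<longlonglongrightarrow> (-1) * (-1) ^ k"
      by (rule tendsto_mult[OF step Suc])
    moreover have "(\<gamma> (2 * (Suc (m + k) + k0)) / \<gamma> (2 * (m + k + k0)) * A (m + k0)) *
        (\<gamma> (2 * (m + k0 + k)) / \<gamma> (2 * (m + k0)) * A (m + k0) ^ k)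
        = \<gamma> (2 * (m + k0 + Suc k)) / \<gamma> (2 * (m + k0)) * A (m + k0) ^ Suc k" for m
    proof -
      have e: "m + k0 + k = m + k + k0" "m + k0 + Suc k = Suc (m + k) + k0" by auto
      show ?thesis unfolding e using gam_nz[of "m + k"] by (simp add: field_simps)
    qed
    ultimately show ?case by simp
  qed
  then show ?thesis unfolding A_def by (rule LIMSEQ_offset)
qed

lemma uniform_limit_poly_sum:
  fixes c :: "nat \<Rightarrow> nat \<Rightarrow> complex"
  assumes K: "compact K" and c: "\<And>k. k \<le> d \<Longrightarrow> (\<lambda>n. c n k) \<longlonglongrightarrow> l k"
  shows "uniform_limit K (\<lambda>n z. \<Sum>k\<le>d. c n k * z ^ k) (\<lambda>z. \<Sum>k\<le>d. l k * z ^ k) sequentially"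
proof -
  have "uniform_limit K (\<lambda>n z. c n k * z ^ k) (\<lambda>z. l k * z ^ k) sequentially" if "k \<le> d" for k
  proof -
    have "uniform_limit K (\<lambda>n z. c n k) (\<lambda>z. l k) sequentially"
      using c[OF that] by (auto simp: uniform_limit_iff tendsto_iff elim!: eventually_mono)
    moreover have "compact ((\<lambda>z. z ^ k) ` K)"
      by (intro compact_continuous_image K continuous_intros)
    ultimately show ?thesis
      by (intro uniform_lim_mult uniform_limit_const compact_imp_bounded) (auto simp: image_constant_conv)
  qed
  then show ?thesis
    by (induction d) (auto intro!: uniform_limit_add simp del: power_Suc)
qed
theorem theorem2p4:
  fixes f :: "complex \<Rightarrow> complex" and \<gamma> :: "nat \<Rightarrow> complex" and \<alpha> :: real and d :: nat
  assumes entire: "f holomorphic_on UNIV"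
    and even: "\<And>z. f (- z) = f z"
    and order: "entire_order f < 2"
    and real_on_reals: "\<And>x::real. f (of_real x) \<in> \<real>"
    and real_roots: "\<And>z. f z = 0 \<Longrightarrow> z \<in> \<real>"
    and series: "\<And>z. (\<lambda>k. \<gamma> (2 * k) * z ^ (2 * k) / fact (2 * k)) sums f z"
    and alpha: "0 < \<alpha>" "\<alpha> < 2"
    and regular_variation:
      "\<And>x::real. x > 0 \<Longrightarrow>
         ((\<lambda>r. real (n_plus f (x * r)) / real (n_plus f r)) \<longlongrightarrow> x powr \<alpha>) at_top"
  shows "(\<forall>K. compact K \<longrightarrow>
           uniform_limit K
             (\<lambda>n z. 1 / \<gamma> (2 * n) *
                poly (even_jensen_poly d ((deriv ^^ (2 * n)) f)) (of_real (scale_seq f \<alpha> n) * z))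
             (\<lambda>z. 4 ^ d * ((fact d)\<^sup>2 / fact (2 * d)) * poly (laguerre_poly (- 1 / 2) d) (z / 4))
             sequentially) \<and>
         even_jensen_poly d cos =
           smult (4 ^ d * ((fact d)\<^sup>2 / fact (2 * d)))
             (pcompose (laguerre_poly (- 1 / 2) d) [:0, 1 / 4:])"
proof (intro conjI allI impI)
  show cos_poly: "even_jensen_poly d cos =
      smult (4 ^ d * ((fact d)\<^sup>2 / fact (2 * d))) (pcompose (laguerre_poly (- 1 / 2) d) [:0, 1 / 4:])"
    by (rule even_jensen_poly_cos)
  fix K :: "complex set" assume K: "compact K"
  define A where "A n = complex_of_real (scale_seq f \<alpha> n)" for n
  have poly_eq: "poly (even_jensen_poly d h) z = (\<Sum>k\<le>d. of_nat (d choose k) * jensen_coeff h k * z ^ k)" for h z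
    by (simp add: even_jensen_poly_def poly_sum poly_monom)
  have target: "4 ^ d * ((fact d)\<^sup>2 / fact (2 * d)) * poly (laguerre_poly (- 1 / 2) d) (z / 4)
      = (\<Sum>k\<le>d. of_nat (d choose k) * jensen_coeff cos k * z ^ k)" for z :: complex
    unfolding poly_eq[symmetric] cos_poly by (simp add: poly_pcompose)
  have deriv_0: "(deriv ^^ (2 * k)) f 0 = \<gamma> (2 * k)" for k
    using higher_deriv_even_power_series_0[of "\<lambda>k. \<gamma> (2 * k) / fact (2 * k)" f k] series by simp
  have coeff: "jensen_coeff ((deriv ^^ (2 * n)) f) k = fact k / fact (2 * k) * \<gamma> (2 * (n + k))" for n k
  proof -
    have "(deriv ^^ (2 * k)) ((deriv ^^ (2 * n)) f) 0 = \<gamma> (2 * (n + k))"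
      using deriv_0[of "n + k"] by (simp add: funpow_add[symmetric, THEN fun_cong, unfolded o_def] add.commute algebra_simps)
    then show ?thesis by (simp add: jensen_coeff_def)
  qed
  have source: "1 / \<gamma> (2 * n) * poly (even_jensen_poly d ((deriv ^^ (2 * n)) f)) (A n * z)
      = (\<Sum>k\<le>d. of_nat (d choose k) * (fact k / fact (2 * k)) * (\<gamma> (2 * (n + k)) / \<gamma> (2 * n) * A n ^ k) * z ^ k)" for n z
    unfolding poly_eq coeff by (simp add: sum_distrib_left power_mult_distrib mult_ac)
  have "(\<lambda>n. of_nat (d choose k) * (fact k / fact (2 * k)) * (\<gamma> (2 * (n + k)) / \<gamma> (2 * n) * A n ^ k))
      \<longlonglongrightarrow> of_nat (d choose k) * jensen_coeff cos k" for k
  proof -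
    have "(\<lambda>n. of_nat (d choose k) * (fact k / fact (2 * k)) * (\<gamma> (2 * (n + k)) / \<gamma> (2 * n) * A n ^ k))
      \<longlonglongrightarrow> of_nat (d choose k) * (fact k / fact (2 * k)) * (-1) ^ k"
      unfolding A_def
      by (intro tendsto_mult_left gamma_ratio_asymptotics[OF entire order real_roots series alpha regular_variation])
    then show ?thesis by (simp add: jensen_coeff_cos mult_ac)
  qed
  then show "uniform_limit K
     (\<lambda>n z. 1 / \<gamma> (2 * n) * poly (even_jensen_poly d ((deriv ^^ (2 * n)) f)) (of_real (scale_seq f \<alpha> n) * z))
     (\<lambda>z. 4 ^ d * ((fact d)\<^sup>2 / fact (2 * d)) * poly (laguerre_poly (- 1 / 2) d) (z / 4)) sequentially"
    unfolding A_def[symmetric] source target by (intro uniform_limit_poly_sum[OF K])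
qed

end
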